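(* Let $P$ be an $n$-dimensional lattice polytope in $\mathbb{R}^n$ of degree $d$. Then $P$ decomposes as a Cayley sum of lattice polytopes in $\mathbb{R}^q$ for some $q \leq (d^2 + 19d - 4)/2$.
   Context: A lattice polytope is the convex hull of finitely many lattice points. For an $n$-dimensional lattice polytope $P\subset\mathbb{R}^n$, write $\sum_{m\ge0}|mP\cap\mathbb{Z}^n|t^m = h^*_P(t)/(1-t)^{n+1}$ with $h^*_P$ a polynomial; the degree $d$ of $P$ is the degree of $h^*_P$. Equivalently, $d$ is the largest nonnegative integer such that $(n-d)P$ has no lattice points in its (relative) interior. If $P_0,\dots,P_s$ are lattice polytopes in $\mathbb{R}^q$, their Cayley sum $P_0*\cdots*P_s$ is the convex hull of $(P_0\times 0)\cup(P_1\times e_1)\cup\cdots\cup(P_s\times e_s)$ in $\mathbb{R}^q\times\mathbb{R}^s$, where $e_1,\dots,e_s$ is the standard basis of $\mathbb{R}^s$. $P$ decomposes as a Cayley sum of lattice polytopes in $\mathbb{R}^q$ if there is an affine isomorphism $\mathbb{R}^n\cong\mathbb{R}^q\times\mathbb{R}^s$ mapping $\mathbb{Z}^n$ onto $\mathbb{Z}^q\times\mathbb{Z}^s$ and identifying $P$ with $P_0*\cdots*P_s$ for some lattice polytopes $P_0,\dots,P_s\subset\mathbb{R}^q$.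
   Formalization: The degree d is assumed to be at least 1; for d = 0 (e.g. a unimodular simplex) the bound (d^2+19d-4)/2 equals -2, so no q ≥ 0 satisfies it and the claim fails as stated. *)

theory Defs
  imports "HOL-Analysis.Analysis" "HOL-Computational_Algebra.Formal_Power_Series"
begin

text \<open>The lattice Z^n inside R^n = real^'n (n = CARD('n)).\<close>
definition lattice_points :: "(real^'n) set" where
  "lattice_points = {x. \<forall>i. x $ i \<in> \<int>}"

text \<open>Lattice polytope: convex hull of finitely many (at least one) lattice points.\<close>
definition lattice_polytope :: "(real^'n) set \<Rightarrow> bool" where
  "lattice_polytope P \<longleftrightarrow>
     (\<exists>S. finite S \<and> S \<noteq> {} \<and> S \<subseteq> lattice_points \<and> P = convex hull S)"

text \<open>Ehrhart series  sum_m |mP \<inter> Z^n| t^m.\<close>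
definition ehrhart_series :: "(real^'n) set \<Rightarrow> int fps" where
  "ehrhart_series P = Abs_fps (\<lambda>m. int (card (((*\<^sub>R) (real m) ` P) \<inter> lattice_points)))"

text \<open>h*-series: (1-t)^(n+1) times the Ehrhart series (a polynomial for lattice polytopes).\<close>
definition h_star :: "(real^'n) set \<Rightarrow> int fps" where
  "h_star P = (1 - fps_X) ^ (CARD('n) + 1) * ehrhart_series P"

text \<open>Degree of P = degree of the polynomial h*_P.\<close>
definition lattice_degree :: "(real^'n) set \<Rightarrow> nat" where
  "lattice_degree P = (GREATEST k. fps_nth (h_star P) k \<noteq> 0)"

text \<open>Vertex of the standard simplex used in the Cayley sum: e_0 = 0, e_j = unit vector.\<close>
definition cayley_vertex :: "'n option \<Rightarrow> real^'n" where
  "cayley_vertex k = (case k of None \<Rightarrow> 0 | Some j \<Rightarrow> axis j 1)"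

text \<open>P decomposes as a Cayley sum of lattice polytopes in R^q:
  after a lattice-preserving affine automorphism of R^n, with the coordinates split as
  (coordinates outside J) = R^q and (coordinates in J) = R^s, s = card J,
  P becomes conv((P_0 x 0) \<union> (P_j x e_j), j \<in> J) with lattice polytopes P_k \<subseteq> R^q.\<close>
definition cayley_decomposes :: "(real^'n) set \<Rightarrow> nat \<Rightarrow> bool" where
  "cayley_decomposes P q \<longleftrightarrow>
     (\<exists>(J::'n set) (g::real^'n \<Rightarrow> real^'n) (c::real^'n) (Q::'n option \<Rightarrow> (real^'n) set).
        q + card J = CARD('n) \<and>
        linear g \<and> bij (\<lambda>x. g x + c) \<and>
        (\<lambda>x. g x + c) ` lattice_points = lattice_points \<and>
        (\<forall>k \<in> insert None (Some ` J).
            lattice_polytope (Q k) \<and> (\<forall>x \<in> Q k. \<forall>j \<in> J. x $ j = 0)) \<and>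
        (\<lambda>x. g x + c) ` P =
          convex hull (\<Union>k \<in> insert None (Some ` J). (\<lambda>x. x + cayley_vertex k) ` Q k))"

end

theory Submission
  imports Defs "HOL-Computational_Algebra.Polynomial"
begin

text \<open>
  Work in the cone \<open>C\<close> over \<open>P \<times> {1}\<close>, of dimension \<open>n + 1\<close>. A half-open triangulation of \<open>C\<close>
  writes \<open>h\<^sup>*\<close> as a sum over lattice points of half-open parallelepipeds; hence a lattice point of
  height \<open>k\<close> in the interior of \<open>C\<close> forces \<open>k \<ge> n + 1 - d\<close>, and a lattice point of height \<open>k\<close>
  spans a face of dimension at most \<open>k + d\<close>.

  Apply this to sums of sets \<open>A\<close> of generators. If \<open>A\<close> is chosen such that the excess of the
  dimension of its face \<open>F\<close> over \<open>card A\<close> cannot be raised by adding few generators, then the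
  two sides of every circuit modulo \<open>F\<close> are so small that \<open>C / F\<close> is simplicial; and
  \<open>2 dim F \<le> d\<^sup>2 + 5 d + 2\<close>. The coordinates of \<open>C / F\<close>, normalised to have maximum 1 on the
  generators, take values in \<open>[0, 1]\<close>. They are part of the barycentric coordinates of a lattice
  simplex, fewer than \<open>4 d\<close> of which are not integral, because every point of the fundamental
  parallelepiped has at most \<open>2 d\<close> nonzero coordinates. The integral ones map the generators onto
  the vertices of a unimodular simplex, which is a Cayley decomposition.
\<close>

text \<open>The excess \<open>dim F - card A\<close> never exceeds \<open>d\<close>, so raising it
  must stop. Take a relation \<open>v + n = p + z\<close> with \<open>z\<close> in the span of
  \<open>F\<close> and \<open>n\<close>, \<open>p\<close> positive combinations of disjoint parts of
  a basis. Adding one side to \<open>A\<close> pulls the other side into the face, because a face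
  contains the summands of its elements, and what comes for free raises the excess. Maximality
  leaves only \<open>n = 0\<close> and at most one term in \<open>p\<close>. A raise from excess
  \<open>j\<close> costs at most \<open>d + 1 - j\<close> generators, which is the origin of the
  quadratic term. Half-open cells partition the lattice points without overlap, so coefficients
  become counts and no cancellation can hide a point of a parallelepiped. A simplicial quotient need
  not be unimodular; the coordinates that are somewhere fractional are discarded. Altogether
  \<open>n + 1 \<le> card M + (d^2 + 5d + 2)/2 + (4d - 1)\<close> for the set \<open>M\<close> of
  integral ones, so \<open>q = n - card M\<close> is at most \<open>(d^2 + 13d - 2)/2\<close>, which
  for \<open>d \<ge> 1\<close> lies below the asserted bound.\<close>

lemma common_non_root:
  fixes p :: "'i \<Rightarrow> real poly"
  assumes "finite I" "\<And>i. i \<in> I \<Longrightarrow> p i \<noteq> 0"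
  shows "\<exists>t>0. \<forall>i\<in>I. poly (p i) t \<noteq> 0"
proof -
  have "finite (\<Union>i\<in>I. {t. poly (p i) t = 0})"
    using assms by (auto intro: poly_roots_finite)
  then have "\<not> {0<..} \<subseteq> (\<Union>i\<in>I. {t. poly (p i) t = 0})"
    using infinite_Ioi finite_subset by blast
  then show ?thesis by auto
qed

text \<open>Positivity of \<open>a + e * b\<close> for all small \<open>e > 0\<close>.\<close>

definition lexpos :: "real \<Rightarrow> real \<Rightarrow> bool" where
  "lexpos a b \<longleftrightarrow> a > 0 \<or> (a = 0 \<and> b > 0)"

text \<open>Since \<open>b\<close> is nonzero, no tie remains: close to 0 the sign of
  \<open>a + e * b\<close> is that of \<open>a\<close>, or that of \<open>b\<close> if
  \<open>a = 0\<close>. This turns the opening of facets into an honest perturbation.\<close>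

lemma eventually_lexpos:
  assumes "b \<noteq> 0"
  shows "eventually (\<lambda>e. (lexpos a b \<longleftrightarrow> a + e * b > 0) \<and> a + e * b \<noteq> 0) (at_right 0)"
proof (cases "a = 0")
  case True
  then show ?thesis using assms
    by (intro eventually_mono[OF eventually_at_right_less[of "0::real"]])
      (auto simp: lexpos_def zero_less_mult_iff)
next
  case False
  have lim: "((\<lambda>e. a + e * b) \<longlongrightarrow> a) (at_right 0)"
    by (auto intro!: tendsto_eq_intros)
  show ?thesis
  proof (cases "a > 0")
    case True
    from order_tendstoD(1)[OF lim this] show ?thesis
      by eventually_elim (use True in \<open>auto simp: lexpos_def\<close>)
  next
    case neg: False
    then have "a < 0" using False by simp
    from order_tendstoD(2)[OF lim this] show ?thesis
      by eventually_elim (use neg False in \<open>auto simp: lexpos_def\<close>)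
  qed
qed

section \<open>The cone over a lattice polytope\<close>

text \<open>In the application \<open>'a\<close> is \<open>(real^'n) \<times> real\<close>, so
  \<open>DIM('a)\<close> is \<open>n + 1\<close>, \<open>V\<close> consists of points
  \<open>(x, 1)\<close> and \<open>L\<close> is the integer lattice. What enters of \<open>L\<close>
  is that it is a subgroup containing \<open>V\<close>, with integral heights and finitely many
  points in bounded sets.\<close>

locale lattice_cone =
  fixes V L :: "'a::euclidean_space set" and ht :: "'a \<Rightarrow> real"
  assumes finite_V: "finite V"
    and span_V: "span V = UNIV"
    and linear_ht: "linear ht"
    and ht_V: "v \<in> V \<Longrightarrow> ht v = 1"
    and V_sub_L: "V \<subseteq> L"
    and L_diff: "x \<in> L \<Longrightarrow> y \<in> L \<Longrightarrow> x - y \<in> L"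
    and ht_L: "x \<in> L \<Longrightarrow> ht x \<in> \<int>"
    and finite_L_bounded: "bounded S \<Longrightarrow> finite (L \<inter> S)"
begin

lemma ht_simps [simp]:
  "ht (x + y) = ht x + ht y" "ht (x - y) = ht x - ht y" "ht (c *\<^sub>R x) = c * ht x" "ht 0 = 0"
  "ht (- x) = - ht x"
  using linear_ht by (auto simp: linear_add linear_diff linear_scale linear_0 linear_neg)

lemma ht_sum: "ht (sum f A) = (\<Sum>i\<in>A. ht (f i))"
  using linear_sum[OF linear_ht] .

lemma V_nonempty: "V \<noteq> {}"
proof
  assume "V = {}"
  then have "(UNIV :: 'a set) = {0}" using span_V by simp
  then show False using nonzero_Basis SOME_Basis by blast
qed

lemma L_0: "0 \<in> L"
  using L_diff V_nonempty V_sub_L by fastforce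

lemma L_minus: "x \<in> L \<Longrightarrow> - x \<in> L"
  using L_diff[OF L_0] by simp

lemma L_add: "x \<in> L \<Longrightarrow> y \<in> L \<Longrightarrow> x + y \<in> L"
  using L_diff[of x "- y"] L_minus[of y] by simp

lemma L_sum: "(\<And>i. i \<in> A \<Longrightarrow> f i \<in> L) \<Longrightarrow> sum f A \<in> L"
  by (induction A rule: infinite_finite_induct) (auto intro: L_0 L_add)

lemma L_scale: "x \<in> L \<Longrightarrow> c \<in> \<int> \<Longrightarrow> c *\<^sub>R x \<in> L"
proof -
  assume x: "x \<in> L" and "c \<in> \<int>"
  then obtain k where c: "c = of_int k" by (auto elim: Ints_cases)
  have *: "of_nat n *\<^sub>R x \<in> L" for n
    by (induction n) (auto simp: scaleR_left_distrib intro: L_0 L_add x)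
  have "of_int k *\<^sub>R x \<in> L"
    by (cases k rule: int_cases2) (use *[of "nat \<bar>k\<bar>"] in \<open>auto intro: L_minus dest: L_minus\<close>)
  then show ?thesis using c by simp
qed

section \<open>The polyhedral cone and its height slices\<close>

definition pcone :: "'a set" where
  "pcone = {x. \<exists>a. (\<forall>v\<in>V. a v \<ge> 0) \<and> x = (\<Sum>v\<in>V. a v *\<^sub>R v)}"

lemma coneE:
  assumes "x \<in> pcone"
  obtains a where "\<forall>v\<in>V. a v \<ge> 0" "x = (\<Sum>v\<in>V. a v *\<^sub>R v)"
  using assms unfolding pcone_def by auto

lemma coneI:
  assumes "S \<subseteq> V" and "\<And>v. v \<in> S \<Longrightarrow> a v \<ge> 0"
  shows "(\<Sum>v\<in>S. a v *\<^sub>R v) \<in> pcone"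
proof -
  have "(\<Sum>v\<in>S. a v *\<^sub>R v) = (\<Sum>v\<in>V. (if v \<in> S then a v else 0) *\<^sub>R v)"
    using assms(1) finite_V by (intro sum.mono_neutral_cong_left) auto
  moreover have "\<forall>v\<in>V. 0 \<le> (if v \<in> S then a v else 0)" using assms(2) by auto
  ultimately show ?thesis unfolding pcone_def
    by (intro CollectI exI[of _ "\<lambda>v. if v \<in> S then a v else 0"] conjI)
qed

lemma cone_V: "v \<in> V \<Longrightarrow> v \<in> pcone"
  using coneI[of "{v}" "\<lambda>_. 1"] by simp

lemma cone_0 [simp]: "0 \<in> pcone"
  using coneI[of "{}"] by simp

lemma cone_add: "x \<in> pcone \<Longrightarrow> y \<in> pcone \<Longrightarrow> x + y \<in> pcone"
proof -
  assume "x \<in> pcone" "y \<in> pcone"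
  then obtain a b where "\<forall>v\<in>V. a v \<ge> 0" "x = (\<Sum>v\<in>V. a v *\<^sub>R v)"
    "\<forall>v\<in>V. b v \<ge> 0" "y = (\<Sum>v\<in>V. b v *\<^sub>R v)" unfolding pcone_def by blast
  then show "x + y \<in> pcone" unfolding pcone_def
    by (intro CollectI exI[of _ "\<lambda>v. a v + b v"]) (auto simp: sum.distrib scaleR_left_distrib)
qed

lemma cone_scale: "x \<in> pcone \<Longrightarrow> c \<ge> 0 \<Longrightarrow> c *\<^sub>R x \<in> pcone"
proof -
  assume "x \<in> pcone" "c \<ge> 0"
  then obtain a where "\<forall>v\<in>V. a v \<ge> 0" "x = (\<Sum>v\<in>V. a v *\<^sub>R v)" unfolding pcone_def by blast
  with \<open>c \<ge> 0\<close> show "c *\<^sub>R x \<in> pcone" unfolding pcone_def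
    by (intro CollectI exI[of _ "\<lambda>v. c * a v"]) (auto simp: scaleR_sum_right)
qed

lemma cone_sum: "(\<And>i. i \<in> A \<Longrightarrow> f i \<in> pcone) \<Longrightarrow> sum f A \<in> pcone"
  by (induction A rule: infinite_finite_induct) (auto intro: cone_add)

lemma ht_cone_nonneg: "x \<in> pcone \<Longrightarrow> ht x \<ge> 0"
  unfolding pcone_def by (auto simp: ht_sum ht_V intro!: sum_nonneg)

text \<open>The coefficients of an element of the cone sum to its height, which bounds its norm.
  Finite slices give the cardinalities in the Hilbert series their meaning.\<close>

lemma finite_level: "finite {x \<in> L \<inter> pcone. ht x = c}"
proof -
  obtain b where b: "\<And>v. v \<in> V \<Longrightarrow> norm v \<le> b"
    using finite_imp_bounded[OF finite_V] by (auto simp: bounded_iff)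
  have "norm x \<le> c * b" if x: "x \<in> pcone" "ht x = c" for x
  proof -
    obtain a where a: "\<forall>v\<in>V. a v \<ge> 0" "x = (\<Sum>v\<in>V. a v *\<^sub>R v)"
      using x(1) by (rule coneE)
    have "norm x \<le> (\<Sum>v\<in>V. a v * b)"
      unfolding a(2)
    proof (rule sum_norm_le)
      fix v assume "v \<in> V"
      then show "norm (a v *\<^sub>R v) \<le> a v * b" using a(1) b by (simp add: mult_left_mono)
    qed
    also have "\<dots> = c * b" using x(2) a(2) by (simp add: ht_sum ht_V flip: sum_distrib_right)
    finally show ?thesis .
  qed
  then have "bounded {x \<in> pcone. ht x = c}" by (intro boundedI[of _ "c * b"]) auto
  from finite_L_bounded[OF this] show ?thesis by (rule finite_subset[rotated]) auto
qed

section \<open>Coordinates in bases chosen among the generators\<close>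

definition bases :: "'a set set" where
  "bases = {s. s \<subseteq> V \<and> independent s \<and> span s = UNIV}"

abbreviation coord :: "'a set \<Rightarrow> 'a \<Rightarrow> 'a \<Rightarrow> real" where
  "coord \<equiv> real_vector.representation"

lemma finite_bases: "finite bases"
  using finite_V unfolding bases_def by (auto intro: finite_subset[of _ "Pow V"])

lemma basesD:
  assumes "s \<in> bases"
  shows "s \<subseteq> V" "independent s" "span s = UNIV" "finite s" "card s = DIM('a)"
proof -
  show *: "s \<subseteq> V" "independent s" "span s = UNIV" using assms unfolding bases_def by auto
  then show "finite s" using finite_V finite_subset by blast
  show "card s = DIM('a)" using * by (metis dim_UNIV dim_span_eq_card_independent)
qed

lemma basesI:
  assumes "s \<subseteq> V" "span s = UNIV" "card s \<le> DIM('a)"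
  shows "s \<in> bases"
  unfolding bases_def using assms finite_V finite_subset[OF assms(1)]
  using card_le_dim_spanning[of s UNIV] by auto

lemma coord_linear:
  assumes "s \<in> bases"
  shows "linear (\<lambda>x. coord s x i)"
  using basesD[OF assms]
  by (intro linearI) (auto simp: real_vector.representation_add real_vector.representation_scale)

lemma coord_add:
  assumes "s \<in> bases" shows "coord s (x + y) i = coord s x i + coord s y i"
  using linear_add[OF coord_linear[OF assms]] .
lemma coord_diff:
  assumes "s \<in> bases" shows "coord s (x - y) i = coord s x i - coord s y i"
  using linear_diff[OF coord_linear[OF assms]] .
lemma coord_minus:
  assumes "s \<in> bases" shows "coord s (- x) i = - coord s x i"
  using linear_neg[OF coord_linear[OF assms]] .
lemma coord_scale:
  assumes "s \<in> bases" shows "coord s (c *\<^sub>R x) i = c * coord s x i"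
  using linear_scale[OF coord_linear[OF assms]] by simp
lemma coord_sum:
  assumes "s \<in> bases" shows "coord s (sum f A) i = (\<Sum>j\<in>A. coord s (f j) i)"
  using linear_sum[OF coord_linear[OF assms]] .

lemma coord_basis:
  assumes "s \<in> bases" "v \<in> s" shows "coord s v i = (if i = v then 1 else 0)"
  using basesD[OF assms(1)] assms(2) by (auto simp: real_vector.representation_basis)

lemma coord_eq:
  assumes "s \<in> bases" shows "(\<Sum>i\<in>s. coord s x i *\<^sub>R i) = x"
  using basesD[OF assms] by (intro real_vector.sum_representation_eq) auto

lemma coord_comb:
  assumes "s \<in> bases" "i \<in> s"
  shows "coord s (\<Sum>j\<in>s. a j *\<^sub>R j) i = a i"
proof -
  have "coord s (\<Sum>j\<in>s. a j *\<^sub>R j) i = (\<Sum>j\<in>s. if i = j then a j else 0)"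
    by (auto simp: coord_sum coord_scale coord_basis assms intro!: sum.cong)
  then show ?thesis using assms basesD(4) by simp
qed

text \<open>All generators have height 1, so coordinates in a basis act as barycentric coordinates
  on each slice.\<close>

lemma coord_ht:
  assumes "s \<in> bases"
  shows "ht x = (\<Sum>i\<in>s. coord s x i)"
proof -
  have "ht x = ht (\<Sum>i\<in>s. coord s x i *\<^sub>R i)" using coord_eq[OF assms] by simp
  also have "\<dots> = (\<Sum>i\<in>s. coord s x i * ht i)" by (simp add: ht_sum)
  also have "\<dots> = (\<Sum>i\<in>s. coord s x i)"
    by (intro sum.cong) (use basesD(1)[OF assms] ht_V in auto)
  finally show ?thesis .
qed

lemma coord_eqI:
  assumes "s \<in> bases" "\<And>i. i \<in> s \<Longrightarrow> coord s x i = coord s y i"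
  shows "x = y"
  using assms by (metis (no_types, lifting) coord_eq sum.cong)

lemma basis_in_cone:
  assumes "s \<in> bases" "\<And>i. i \<in> s \<Longrightarrow> coord s x i \<ge> 0"
  shows "x \<in> pcone"
  using coneI[of s "coord s x"] assms coord_eq basesD(1) by metis

lemma extend_to_basis:
  assumes "independent S" "S \<subseteq> V"
  obtains s where "S \<subseteq> s" "s \<in> bases"
proof -
  obtain s where "S \<subseteq> s" "s \<subseteq> V" "independent s" "V \<subseteq> span s"
    using maximal_independent_subset_extend[OF assms(2,1)] by metis
  then have "s \<in> bases" unfolding bases_def using span_V span_mono[of V "span s"] unfolding span_span by auto
  then show ?thesis using that \<open>S \<subseteq> s\<close> by blast
qed

lemma basis_exchange:
  assumes "s \<in> bases" "i \<in> s" "v \<in> V" "coord s v i \<noteq> 0"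
  shows "insert v (s - {i}) \<in> bases"
proof (rule basesI)
  note b = basesD[OF assms(1)]
  show "insert v (s - {i}) \<subseteq> V" using b assms by auto
  have vs: "v = (\<Sum>j\<in>s - {i}. coord s v j *\<^sub>R j) + coord s v i *\<^sub>R i"
    using coord_eq[OF assms(1), of v] sum.remove[OF b(4) assms(2), of "\<lambda>j. coord s v j *\<^sub>R j"]
    by (simp add: add.commute)
  let ?T = "span (insert v (s - {i}))"
  have "v - (\<Sum>j\<in>s - {i}. coord s v j *\<^sub>R j) \<in> ?T"
    by (intro span_diff span_sum span_scale) (auto intro: span_base)
  then have "coord s v i *\<^sub>R i \<in> ?T" using vs by (metis add_diff_cancel_left')
  then have "inverse (coord s v i) *\<^sub>R coord s v i *\<^sub>R i \<in> ?T" by (rule span_scale)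
  then have "i \<in> ?T" using assms(4) by simp
  then have "s \<subseteq> ?T" by (auto intro: span_base)
  then show "?T = UNIV" using b(3) using span_mono[of s ?T] unfolding span_span by auto
  have "card s > 0" using b(4) assms(2) card_gt_0_iff by blast
  then show "card (insert v (s - {i})) \<le> DIM('a)"
    using card_insert_le_m1[of "card s" "s - {i}" v] b(4,5) assms(2) by simp
qed

section \<open>Half-open triangulations and the degree\<close>

text \<open>\<open>reduced_cost w s j\<close> is the reduced cost of the simplex algorithm: the objective change, per
  unit of \<open>j\<close>, when the non-basic vector \<open>j\<close> enters the basis \<open>s\<close>.\<close>

definition reduced_cost :: "('a \<Rightarrow> real) \<Rightarrow> 'a set \<Rightarrow> 'a \<Rightarrow> real" where
  "reduced_cost w s j = w j - (\<Sum>i\<in>s. w i * coord s j i)"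

text \<open>The strictly dual feasible bases of the linear program with cost \<open>w\<close>.
  Geometrically, each generator \<open>v\<close> is lifted to \<open>w v\<close>; when no reduced
  cost off a basis vanishes, these are the cells of the regular triangulation given by the lower
  hull.\<close>

definition optimal_bases :: "('a \<Rightarrow> real) \<Rightarrow> 'a set set" where
  "optimal_bases w = {s \<in> bases. \<forall>j\<in>V - s. reduced_cost w s j > 0}"

text \<open>Such a point avoids every hyperplane spanned by generators, so it lies on the boundary
  of no simplicial cone over a basis.\<close>

definition generic :: "'a \<Rightarrow> bool" where
  "generic z \<longleftrightarrow> (\<forall>s\<in>bases. \<forall>i\<in>s. coord s z i \<noteq> 0)"

text \<open>The tableau identity of linear programming: reduced costs vanish on \<open>s\<close>
  itself, so after elimination of the basic part only generators outside \<open>s\<close>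
  contribute.\<close>

lemma weighted_sum_via_reduced_costs:
  assumes "s \<in> bases" "z = (\<Sum>v\<in>V. a v *\<^sub>R v)"
  shows "(\<Sum>v\<in>V. w v * a v) =
    (\<Sum>i\<in>s. w i * coord s z i) + (\<Sum>j\<in>V - s. reduced_cost w s j * a j)"
proof -
  note b = basesD[OF assms(1)]
  have rc0: "reduced_cost w s j = 0" if "j \<in> s" for j
  proof -
    have "(\<Sum>i\<in>s. w i * coord s j i) = (\<Sum>i\<in>s. if i = j then w i else 0)"
      by (intro sum.cong) (auto simp: coord_basis assms that)
    then show ?thesis using that b(4) by (simp add: reduced_cost_def)
  qed
  have "(\<Sum>i\<in>s. w i * coord s z i) = (\<Sum>i\<in>s. \<Sum>v\<in>V. w i * (a v * coord s v i))"
    by (simp add: assms coord_sum coord_scale sum_distrib_left)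
  also have "\<dots> = (\<Sum>v\<in>V. \<Sum>i\<in>s. w i * (a v * coord s v i))"
    by (rule sum.swap)
  also have "\<dots> = (\<Sum>v\<in>V. a v * (w v - reduced_cost w s v))"
    by (simp add: reduced_cost_def sum_distrib_left mult.left_commute)
  finally have 1: "(\<Sum>v\<in>V. w v * a v) = (\<Sum>i\<in>s. w i * coord s z i) + (\<Sum>v\<in>V. reduced_cost w s v * a v)"
    by (simp add: algebra_simps sum_subtractf)
  have "(\<Sum>v\<in>V. reduced_cost w s v * a v) = (\<Sum>v\<in>V - s. reduced_cost w s v * a v)"
    using finite_V by (intro sum.mono_neutral_right) (auto simp: rc0)
  with 1 show ?thesis by simp
qed

text \<open>Padding with zeros makes a basic solution a combination over all of \<open>V\<close>,
  the form in which two bases can be compared.\<close>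

lemma coord_sum_over_V:
  assumes "s \<in> bases"
  shows "(\<Sum>v\<in>V. (if v \<in> s then coord s z v else 0) *\<^sub>R v) = z"
    and "(\<Sum>v\<in>V. w v * (if v \<in> s then coord s z v else 0)) = (\<Sum>i\<in>s. w i * coord s z i)"
proof -
  note b = basesD[OF assms]
  have "(\<Sum>v\<in>V. (if v \<in> s then coord s z v else 0) *\<^sub>R v) = (\<Sum>i\<in>s. coord s z i *\<^sub>R i)"
    using b finite_V by (intro sum.mono_neutral_cong_right) auto
  then show "(\<Sum>v\<in>V. (if v \<in> s then coord s z v else 0) *\<^sub>R v) = z" by (simp add: coord_eq assms)
  show "(\<Sum>v\<in>V. w v * (if v \<in> s then coord s z v else 0)) = (\<Sum>i\<in>s. w i * coord s z i)"
    using b finite_V by (intro sum.mono_neutral_cong_right) auto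
qed

text \<open>Caratheodory: a positive representation with as few generators as possible is
  independent, and genericity forbids a zero coordinate after extension to a basis.\<close>

lemma positive_basis_exists:
  assumes z: "z \<in> pcone" "generic z"
  shows "\<exists>s\<in>bases. \<forall>i\<in>s. coord s z i > 0"
proof -
  define Q where "Q S \<longleftrightarrow> S \<subseteq> V \<and> (\<exists>a. (\<forall>v\<in>S. a v > 0) \<and> z = (\<Sum>v\<in>S. a v *\<^sub>R v))" for S
  obtain a0 where a0: "\<forall>v\<in>V. a0 v \<ge> 0" "z = (\<Sum>v\<in>V. a0 v *\<^sub>R v)" using z(1) by (rule coneE)
  have "z = (\<Sum>v\<in>{v\<in>V. a0 v > 0}. a0 v *\<^sub>R v)"
    unfolding a0(2) using finite_V a0(1) by (intro sum.mono_neutral_right) (auto simp: less_le)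
  then have "Q {v\<in>V. a0 v > 0}" unfolding Q_def by blast
  then obtain S where S: "Q S" and min: "\<And>S'. Q S' \<Longrightarrow> card S \<le> card S'"
    using ex_has_least_nat[of Q _ card] by blast
  obtain a where a: "\<And>v. v \<in> S \<Longrightarrow> a v > 0" "z = (\<Sum>v\<in>S. a v *\<^sub>R v)" and SV: "S \<subseteq> V"
    using S unfolding Q_def by blast
  have finS: "finite S" using SV finite_V finite_subset by blast
  have "independent S"
  proof
    assume "dependent S"
    then obtain u0 where u0: "(\<Sum>v\<in>S. u0 v *\<^sub>R v) = 0" "\<exists>v\<in>S. u0 v \<noteq> 0"
      using dependent_finite[OF finS] by blast
    \<comment> \<open>Every generator has height 1, so a linear relation has coefficient sum 0 and
      therefore a positive coefficient.\<close>
    have sum0: "(\<Sum>v\<in>S. u0 v) = 0"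
    proof -
      have "ht (\<Sum>v\<in>S. u0 v *\<^sub>R v) = (\<Sum>v\<in>S. u0 v)"
        using SV by (auto simp: ht_sum ht_V intro!: sum.cong)
      then show ?thesis using u0(1) by simp
    qed
    have "\<exists>v\<in>S. u0 v > 0"
    proof (rule ccontr)
      assume "\<not> ?thesis"
      then have "\<forall>v\<in>S. - u0 v \<ge> 0" by auto
      moreover have "(\<Sum>v\<in>S. - u0 v) = 0" using sum0 by (simp add: sum_negf)
      ultimately have "\<forall>v\<in>S. - u0 v = 0" using finS by (subst (asm) sum_nonneg_eq_0_iff) auto
      then show False using u0(2) by auto
    qed
    define P where "P = {v\<in>S. u0 v > 0}"
    have P: "finite P" "P \<noteq> {}" using finS \<open>\<exists>v\<in>S. u0 v > 0\<close> by (auto simp: P_def)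
    obtain k where k: "k \<in> P" "\<And>v. v \<in> P \<Longrightarrow> a k / u0 k \<le> a v / u0 v"
      using arg_min_if_finite[OF P, of "\<lambda>v. a v / u0 v"] by (meson not_le)
    \<comment> \<open>The ratio test: the largest step along the relation that keeps all
      coefficients nonnegative. It removes \<open>k\<close> from the support.\<close>
    define t where "t = a k / u0 k"
    have t: "t > 0" using k(1) a(1) by (auto simp: t_def P_def)
    have nn: "a v - t * u0 v \<ge> 0" if "v \<in> S" for v
    proof (cases "u0 v > 0")
      case True
      then have "t \<le> a v / u0 v" using k that by (auto simp: P_def t_def)
      then show ?thesis using True by (simp add: field_simps)
    next
      case False
      then have "t * u0 v \<le> 0" using t by (simp add: mult_nonneg_nonpos)
      then show ?thesis using a(1)[OF that] by linarith
    qed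
    let ?S = "{v\<in>S. a v - t * u0 v > 0}"
    have "z = (\<Sum>v\<in>S. (a v - t * u0 v) *\<^sub>R v)"
      using u0(1) a(2) by (simp add: scaleR_left_diff_distrib sum_subtractf flip: scaleR_sum_right scaleR_scaleR)
    also have "\<dots> = (\<Sum>v\<in>?S. (a v - t * u0 v) *\<^sub>R v)"
      using finS nn by (intro sum.mono_neutral_right) (auto simp: less_le)
    finally have "Q ?S" unfolding Q_def using SV by (auto intro!: exI[of _ "\<lambda>v. a v - t * u0 v"])
    moreover have "k \<in> S - ?S" using k(1) by (auto simp: P_def t_def)
    then have "card ?S < card S" using finS by (intro psubset_card_mono) auto
    ultimately show False using min by fastforce
  qed
  then obtain s where s: "S \<subseteq> s" "s \<in> bases" using extend_to_basis SV by metis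
  have "z = (\<Sum>v\<in>s. (if v \<in> S then a v else 0) *\<^sub>R v)"
    unfolding a(2) using s basesD(4)[OF s(2)] by (intro sum.mono_neutral_cong_left) auto
  then have c: "coord s z i = (if i \<in> S then a i else 0)" if "i \<in> s" for i
    using coord_comb[OF s(2) that, of "\<lambda>v. if v \<in> S then a v else 0"] by simp
  have "coord s z i > 0" if "i \<in> s" for i
    using c[OF that] a(1) z(2) that s(2) unfolding generic_def by (metis (full_types))
  then show ?thesis using s(2) by blast
qed

text \<open>One step of the simplex algorithm: the ratio test keeps the coordinates nonnegative,
  genericity makes them positive, and the cost changes by \<open>t * reduced_cost w s j\<close>,
  which is negative.\<close>

lemma pivot:
  assumes s: "s \<in> bases" "\<forall>i\<in>s. coord s z i > 0" and z: "generic z"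
    and j: "j \<in> V - s" "reduced_cost w s j < 0"
  shows "\<exists>s'\<in>bases. (\<forall>i\<in>s'. coord s' z i > 0) \<and>
    (\<Sum>i\<in>s'. w i * coord s' z i) < (\<Sum>i\<in>s. w i * coord s z i)"
proof -
  note b = basesD[OF s(1)]
  define P where "P = {i\<in>s. coord s j i > 0}"
  \<comment> \<open>The step length is bounded: the coordinates of \<open>j\<close> sum to its
    height 1, so one of them is positive.\<close>
  have "P \<noteq> {}"
  proof
    assume "P = {}"
    then have "\<forall>i\<in>s. coord s j i \<le> 0" by (auto simp: P_def not_less)
    then have "(\<Sum>i\<in>s. coord s j i) \<le> 0" by (simp add: sum_nonpos)
    then show False using coord_ht[OF s(1), of j] ht_V j(1) by simp
  qed
  moreover have "finite P" using b by (simp add: P_def)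
  ultimately obtain k where k: "k \<in> P"
      "\<And>i. i \<in> P \<Longrightarrow> coord s z k / coord s j k \<le> coord s z i / coord s j i"
    using arg_min_if_finite[of P "\<lambda>i. coord s z i / coord s j i"] by (meson not_le)
  define t where "t = coord s z k / coord s j k"
  have ks: "k \<in> s" "coord s j k > 0" using k(1) by (auto simp: P_def)
  have t: "t > 0" using s(2) ks by (simp add: t_def)
  have nn: "coord s z i - t * coord s j i \<ge> 0" if "i \<in> s" for i
  proof (cases "coord s j i > 0")
    case True
    then have "t \<le> coord s z i / coord s j i" using k that by (auto simp: P_def t_def)
    then show ?thesis using True by (simp add: field_simps)
  next
    case False
    then have "t * coord s j i \<le> 0" using t by (simp add: mult_nonneg_nonpos)
    then show ?thesis using s(2) that by fastforce
  qed
  define s' where "s' = insert j (s - {k})"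
  have s': "s' \<in> bases" unfolding s'_def using basis_exchange[OF s(1) ks(1)] j ks(2) by auto
  define c where "c i = (if i = j then t else coord s z i - t * coord s j i)" for i
  have js: "j \<notin> s - {k}" "j \<noteq> k" using j ks by auto
  \<comment> \<open>The leaving index \<open>k\<close> contributes nothing, since its coordinate
    after the step is 0. The same computation serves for the vector and for its cost.\<close>
  have sumf: "(\<Sum>i\<in>s'. f i (c i)) = f j t + (\<Sum>i\<in>s. f i (coord s z i - t * coord s j i))"
    if f: "\<And>i. f i 0 = 0" for f :: "'a \<Rightarrow> real \<Rightarrow> 'b::ab_group_add"
  proof -
    have "(\<Sum>i\<in>s'. f i (c i)) = f j t + (\<Sum>i\<in>s - {k}. f i (c i))"
      using b(4) js by (simp add: s'_def c_def)
    also have "(\<Sum>i\<in>s - {k}. f i (c i)) = (\<Sum>i\<in>s. f i (coord s z i - t * coord s j i))"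
      using b(4) js ks j f by (intro sum.mono_neutral_cong_left) (auto simp: c_def t_def)
    finally show ?thesis .
  qed
  have "(\<Sum>i\<in>s'. c i *\<^sub>R i) = t *\<^sub>R j + (\<Sum>i\<in>s. (coord s z i - t * coord s j i) *\<^sub>R i)"
    by (rule sumf) simp
  also have "(\<Sum>i\<in>s. (coord s z i - t * coord s j i) *\<^sub>R i) = z - t *\<^sub>R j"
    using coord_eq[OF s(1)]
    by (simp add: scaleR_left_diff_distrib sum_subtractf flip: scaleR_sum_right scaleR_scaleR)
  finally have "z = (\<Sum>i\<in>s'. c i *\<^sub>R i)" by simp
  then have cz: "coord s' z i = c i" if "i \<in> s'" for i using coord_comb[OF s' that, of c] by simp
  have "coord s' z i > 0" if "i \<in> s'" for i
  proof -
    have "c i \<ge> 0" using that nn t by (auto simp: c_def s'_def)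
    moreover have "coord s' z i \<noteq> 0" using z s' that by (auto simp: generic_def)
    ultimately show ?thesis using cz[OF that] by simp
  qed
  moreover have "(\<Sum>i\<in>s'. w i * coord s' z i) < (\<Sum>i\<in>s. w i * coord s z i)"
  proof -
    have "(\<Sum>i\<in>s'. w i * coord s' z i) = (\<Sum>i\<in>s'. w i * c i)" using cz by simp
    also have "\<dots> = w j * t + (\<Sum>i\<in>s. w i * (coord s z i - t * coord s j i))"
      by (rule sumf) simp
    also have "\<dots> = (\<Sum>i\<in>s. w i * coord s z i) + t * reduced_cost w s j"
      by (simp add: reduced_cost_def right_diff_distrib sum_subtractf sum_distrib_left mult.left_commute)
    also have "t * reduced_cost w s j < 0" using t j(2) by (simp add: mult_pos_neg)
    finally show ?thesis by simp
  qed
  ultimately show ?thesis using s' by blast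
qed

text \<open>A positive basis of least cost cannot be improved by \<open>pivot\<close>, so it is
  optimal. Conversely an optimal basis costs no more than any positive one, and equality forces the
  latter to be contained in it.\<close>

lemma unique_optimal_basis:
  assumes w: "\<forall>s\<in>bases. \<forall>j\<in>V - s. reduced_cost w s j \<noteq> 0"
    and z: "z \<in> pcone" "generic z"
  shows "\<exists>!s. s \<in> optimal_bases w \<and> (\<forall>i\<in>s. coord s z i > 0)"
proof -
  define F where "F = {s\<in>bases. \<forall>i\<in>s. coord s z i > 0}"
  define cost where "cost s = (\<Sum>i\<in>s. w i * coord s z i)" for s
  have "finite F" "F \<noteq> {}" using positive_basis_exists[OF z] finite_bases by (auto simp: F_def)
  from arg_min_if_finite[OF this, of cost]
  obtain s where s: "s \<in> F" "\<not> (\<exists>s'\<in>F. cost s' < cost s)" by blast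
  have "reduced_cost w s j > 0" if j: "j \<in> V - s" for j
  proof (rule ccontr)
    assume "\<not> ?thesis"
    moreover have "reduced_cost w s j \<noteq> 0" using w j s(1) by (simp add: F_def)
    ultimately have "reduced_cost w s j < 0" by simp
    from pivot[OF _ _ z(2) j this] s show False by (auto simp: F_def cost_def)
  qed
  then have s_opt: "s \<in> optimal_bases w \<and> (\<forall>i\<in>s. coord s z i > 0)"
    using s(1) by (auto simp: optimal_bases_def F_def)
  have le: "cost s1 \<le> cost s2 \<and> (cost s1 = cost s2 \<longrightarrow> s2 \<subseteq> s1)"
    if s1: "s1 \<in> optimal_bases w" and s2: "s2 \<in> bases" "\<forall>i\<in>s2. coord s2 z i > 0" for s1 s2
  proof -
    define a where "a v = (if v \<in> s2 then coord s2 z v else 0)" for v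
    have b1: "s1 \<in> bases" and rc: "\<And>j. j \<in> V - s1 \<Longrightarrow> reduced_cost w s1 j > 0"
      using s1 by (auto simp: optimal_bases_def)
    have "cost s2 = cost s1 + (\<Sum>j\<in>V - s1. reduced_cost w s1 j * a j)"
      using weighted_sum_via_reduced_costs[OF b1, of z a w] coord_sum_over_V[OF s2(1), where z = z]
      by (simp add: a_def cost_def)
    moreover have nn: "\<forall>j\<in>V - s1. reduced_cost w s1 j * a j \<ge> 0"
      using rc s2(2) by (auto simp: a_def intro!: mult_nonneg_nonneg less_imp_le)
    moreover have "s2 \<subseteq> s1" if "(\<Sum>j\<in>V - s1. reduced_cost w s1 j * a j) = 0"
    proof
      fix v assume v: "v \<in> s2"
      then have "a v > 0" using s2(2) by (simp add: a_def)
      show "v \<in> s1"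
      proof (rule ccontr)
        assume "v \<notin> s1"
        then have vV: "v \<in> V - s1" using v basesD(1)[OF s2(1)] by auto
        have "\<forall>j\<in>V - s1. reduced_cost w s1 j * a j = 0"
          using that nn finite_V by (subst (asm) sum_nonneg_eq_0_iff) auto
        then have "reduced_cost w s1 v * a v = 0" using vV by blast
        then show False using rc[OF vV] \<open>a v > 0\<close> by simp
      qed
    qed
    ultimately show ?thesis using sum_nonneg[of "V - s1" "\<lambda>j. reduced_cost w s1 j * a j"] by auto
  qed
  show ?thesis
  proof (rule ex1I[of _ s])
    fix s' assume s': "s' \<in> optimal_bases w \<and> (\<forall>i\<in>s'. coord s' z i > 0)"
    have "s \<in> bases" "s' \<in> bases" using s' s_opt by (auto simp: optimal_bases_def)
    then show "s' = s" using le[of s s'] le[of s' s] s' s_opt by auto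
  qed (rule s_opt)
qed

section \<open>Generic data and the half-open decomposition of the cone\<close>

text \<open>Weights \<open>t ^ f v\<close> with distinct exponents turn each condition into a
  polynomial in \<open>t\<close>. It is nonzero, because its coefficient at \<open>f j\<close> is 1
  for \<open>j\<close> outside \<open>s\<close>.\<close>

lemma generic_weights_exist:
  "\<exists>w. \<forall>s\<in>bases. \<forall>j\<in>V - s. reduced_cost w s j \<noteq> 0"
proof -
  obtain f :: "'a \<Rightarrow> nat" where f: "inj_on f V"
    using finite_V finite_imp_inj_to_nat_seg by metis
  define I where "I = (SIGMA s:bases. V - s)"
  define p where "p = (\<lambda>(s, j). monom 1 (f j) - (\<Sum>i\<in>s. monom (coord s j i) (f i)))"
  have "p (s, j) \<noteq> 0" if "s \<in> bases" "j \<in> V - s" for s j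
  proof -
    have "coeff (p (s, j)) (f j) = 1 - (\<Sum>i\<in>s. 0)"
      using that basesD(1)[OF that(1)] f
      by (simp add: p_def coeff_sum) (rule sum.neutral, use inj_onD[OF f] in fastforce)
    then show ?thesis by force
  qed
  moreover have "finite I" using finite_bases finite_V by (auto simp: I_def)
  ultimately obtain t where t: "\<forall>i\<in>I. poly (p i) t \<noteq> 0"
    using common_non_root[of I p] by (auto simp: I_def)
  have "reduced_cost (\<lambda>v. t ^ f v) s j = poly (p (s, j)) t" for s j
    by (simp add: reduced_cost_def p_def poly_monom poly_sum mult.commute)
  then show ?thesis using t by (intro exI[of _ "\<lambda>v. t ^ f v"]) (auto simp: I_def)
qed

text \<open>For the combination with coefficients \<open>t ^ f v\<close> each coordinate is a
  polynomial in \<open>t\<close>, with coefficient \<open>coord s i i = 1\<close> at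
  \<open>f i\<close>. Choosing \<open>t\<close> positive keeps the point in the cone.\<close>

lemma generic_vector_exists: "\<exists>y\<in>pcone. generic y"
proof -
  obtain f :: "'a \<Rightarrow> nat" where f: "inj_on f V"
    using finite_V finite_imp_inj_to_nat_seg by metis
  define I where "I = (SIGMA s:bases. s)"
  define p where "p = (\<lambda>(s, i). \<Sum>v\<in>V. monom (coord s v i) (f v))"
  have "p (s, i) \<noteq> 0" if s: "s \<in> bases" and i: "i \<in> s" for s i
  proof -
    have iV: "i \<in> V" using basesD(1)[OF s] i by auto
    have "coeff (p (s, i)) (f i) = (\<Sum>v\<in>V. if v = i then 1 else 0)"
      unfolding p_def using iV f s i
      by (auto simp: coeff_sum inj_on_def coord_basis intro!: sum.cong)
    then show ?thesis using iV finite_V by force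
  qed
  moreover have "finite I" using finite_bases basesD(4) by (auto simp: I_def)
  ultimately obtain t where t: "t > 0" "\<forall>i\<in>I. poly (p i) t \<noteq> 0"
    using common_non_root[of I p] by (auto simp: I_def)
  have "coord s (\<Sum>v\<in>V. t ^ f v *\<^sub>R v) i = poly (p (s, i)) t" if "s \<in> bases" for s i
    by (simp add: p_def poly_monom poly_sum mult.commute coord_sum coord_scale that)
  then have "generic (\<Sum>v\<in>V. t ^ f v *\<^sub>R v)" using t(2) by (auto simp: generic_def I_def)
  moreover have "(\<Sum>v\<in>V. t ^ f v *\<^sub>R v) \<in> pcone" using t(1) by (intro coneI) auto
  ultimately show ?thesis by blast
qed

text \<open>For small \<open>e > 0\<close> the point \<open>x + e *\<^sub>R y\<close> is generic
  and, by convexity, in the cone, so exactly one cell has it in its interior. Expressed through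
  \<open>x\<close> alone, this is the lexicographic condition, that is, a choice of open
  facets.\<close>

lemma half_open_decomposition:
  assumes w: "\<forall>s\<in>bases. \<forall>j\<in>V - s. reduced_cost w s j \<noteq> 0"
    and y: "generic y"
    and x: "x \<in> pcone" "x + e0 *\<^sub>R y \<in> pcone" "e0 > 0"
  shows "\<exists>!s. s \<in> optimal_bases w \<and> (\<forall>i\<in>s. lexpos (coord s x i) (coord s y i))"
proof -
  have "eventually (\<lambda>e. \<forall>s\<in>bases. \<forall>i\<in>s.
      (lexpos (coord s x i) (coord s y i) \<longleftrightarrow> coord s (x + e *\<^sub>R y) i > 0) \<and>
      coord s (x + e *\<^sub>R y) i \<noteq> 0) (at_right 0)"
    using y finite_bases basesD(4)
    by (auto simp: eventually_ball_finite_distrib coord_add coord_scale generic_def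
        intro!: eventually_lexpos)
  moreover have "eventually (\<lambda>e. e \<in> {0<..<e0}) (at_right 0)"
    using x(3) by (rule eventually_at_right_real)
  ultimately have "eventually (\<lambda>e. (\<forall>s\<in>bases. \<forall>i\<in>s.
      (lexpos (coord s x i) (coord s y i) \<longleftrightarrow> coord s (x + e *\<^sub>R y) i > 0) \<and>
      coord s (x + e *\<^sub>R y) i \<noteq> 0) \<and> e \<in> {0<..<e0}) (at_right 0)"
    by (rule eventually_conj)
  then obtain e where e: "\<forall>s\<in>bases. \<forall>i\<in>s.
      (lexpos (coord s x i) (coord s y i) \<longleftrightarrow> coord s (x + e *\<^sub>R y) i > 0) \<and>
      coord s (x + e *\<^sub>R y) i \<noteq> 0" "0 < e" "e < e0"
    using eventually_happens[of _ "at_right (0::real)"]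
    unfolding greaterThanLessThan_iff using trivial_limit_at_right_real by blast
  let ?z = "x + e *\<^sub>R y"
  have "?z = (1 - e / e0) *\<^sub>R x + (e / e0) *\<^sub>R (x + e0 *\<^sub>R y)"
    using e(2,3) by (simp add: algebra_simps)
  also have "\<dots> \<in> pcone" using e(2,3) x by (intro cone_add[OF cone_scale cone_scale]) auto
  finally have "?z \<in> pcone" .
  moreover have "generic ?z" using e(1) by (auto simp: generic_def)
  ultimately have "\<exists>!s. s \<in> optimal_bases w \<and> (\<forall>i\<in>s. coord s ?z i > 0)"
    using unique_optimal_basis[OF w] by blast
  moreover have "(s \<in> optimal_bases w \<and> (\<forall>i\<in>s. coord s ?z i > 0)) \<longleftrightarrow>
    (s \<in> optimal_bases w \<and> (\<forall>i\<in>s. lexpos (coord s x i) (coord s y i)))" for s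
    using e(1) by (auto simp: optimal_bases_def)
  ultimately show ?thesis by simp
qed

section \<open>Generating functions of half-open simplicial cones\<close>

definition hilbert_series :: "'a set \<Rightarrow> int fps" where
  "hilbert_series A = Abs_fps (\<lambda>m. int (card {x \<in> A. ht x = real m}))"

definition degree :: nat where
  "degree = (GREATEST k. fps_nth ((1 - fps_X) ^ DIM('a) * hilbert_series (L \<inter> pcone)) k \<noteq> 0)"

lemma finite_level_subset: "A \<subseteq> L \<inter> pcone \<Longrightarrow> finite {x \<in> A. ht x = c}"
  by (rule finite_subset[OF _ finite_level[of c]]) auto

lemma hilbert_series_Un:
  assumes "A \<subseteq> L \<inter> pcone" "B \<subseteq> L \<inter> pcone" "A \<inter> B = {}"
  shows "hilbert_series (A \<union> B) = hilbert_series A + hilbert_series B"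
proof (rule fps_ext)
  fix m
  have "{x \<in> A \<union> B. ht x = real m} = {x \<in> A. ht x = real m} \<union> {x \<in> B. ht x = real m}" by auto
  moreover have "card \<dots> = card {x \<in> A. ht x = real m} + card {x \<in> B. ht x = real m}"
    using assms by (intro card_Un_disjoint finite_level_subset) auto
  ultimately show "fps_nth (hilbert_series (A \<union> B)) m = fps_nth (hilbert_series A + hilbert_series B) m"
    by (simp add: hilbert_series_def)
qed

lemma hilbert_series_shift:
  assumes "A \<subseteq> L \<inter> pcone" "v \<in> V"
  shows "hilbert_series ((+) v ` A) = fps_X * hilbert_series A"
proof (rule fps_ext)
  fix m
  show "fps_nth (hilbert_series ((+) v ` A)) m = fps_nth (fps_X * hilbert_series A) m"
  proof (cases m)
    case 0
    have "ht x \<ge> 1" if "x \<in> (+) v ` A" for x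
      using that ht_cone_nonneg assms by (force simp: ht_V)
    then have "{x \<in> (+) v ` A. ht x = real m} = {}" using 0 by force
    then have "card {x \<in> (+) v ` A. ht x = real m} = 0" by (simp only: card.empty)
    then show ?thesis using 0 by (simp add: hilbert_series_def del: card_eq_0_iff)
  next
    case (Suc k)
    have "{x \<in> (+) v ` A. ht x = real m} = (+) v ` {x \<in> A. ht x = real k}"
      using Suc ht_V[OF assms(2)] by auto
    moreover have "card \<dots> = card {x \<in> A. ht x = real k}"
      by (intro card_image) auto
    ultimately show ?thesis using Suc by (simp add: hilbert_series_def)
  qed
qed

text \<open>For \<open>I = s\<close> this is the set of lattice points of the half-open cone over \<open>s\<close> whose facets are
  opened in direction \<open>y\<close>; for \<open>I = {}\<close> it is the half-open fundamental parallelepiped.\<close>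

definition tile :: "'a set \<Rightarrow> 'a \<Rightarrow> 'a set \<Rightarrow> 'a set" where
  "tile s y I = {x \<in> L. \<forall>i\<in>s. lexpos (coord s x i) (coord s y i) \<and>
     (i \<notin> I \<longrightarrow> \<not> lexpos (coord s x i - 1) (coord s y i))}"

lemma tile_subset:
  assumes "s \<in> bases"
  shows "tile s y I \<subseteq> L \<inter> pcone"
proof
  fix x assume x: "x \<in> tile s y I"
  then have "coord s x i \<ge> 0" if "i \<in> s" for i using that by (auto simp: tile_def lexpos_def)
  then show "x \<in> L \<inter> pcone" using x basis_in_cone[OF assms] by (simp add: tile_def)
qed

text \<open>An element of the larger tile either has its \<open>k\<close>-coordinate in the
  half-open unit interval or remains in the tile after subtraction of \<open>k\<close>. So lifting
  one restriction multiplies the series by \<open>1 / (1 - X)\<close>.\<close>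

lemma tile_insert:
  assumes s: "s \<in> bases" and k: "k \<in> s" "k \<notin> I"
  shows "hilbert_series (tile s y (insert k I)) =
    hilbert_series (tile s y I) + fps_X * hilbert_series (tile s y (insert k I))"
proof -
  have kV: "k \<in> V" using basesD(1)[OF s] k by auto
  have c: "coord s (x - k) i = coord s x i - (if i = k then 1 else 0)"
    "coord s (k + x) i = coord s x i + (if i = k then 1 else 0)" for x i
    by (simp_all add: coord_diff coord_add coord_basis s k)
  have "tile s y (insert k I) \<subseteq> tile s y I \<union> (+) k ` tile s y (insert k I)"
  proof
    fix x assume x: "x \<in> tile s y (insert k I)"
    show "x \<in> tile s y I \<union> (+) k ` tile s y (insert k I)"
    proof (cases "lexpos (coord s x k - 1) (coord s y k)")
      case True
      have "x - k \<in> L" using x kV V_sub_L L_diff by (auto simp: tile_def)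
      then have "x - k \<in> tile s y (insert k I)" using x True by (auto simp: tile_def c)
      then show ?thesis by (intro UnI2 image_eqI[of _ _ "x - k"]) auto
    next
      case False
      then show ?thesis using x k by (auto simp: tile_def)
    qed
  qed
  moreover have "(+) k ` tile s y (insert k I) \<subseteq> tile s y (insert k I)"
  proof (rule image_subsetI)
    fix x assume x: "x \<in> tile s y (insert k I)"
    have "k + x \<in> L" using x kV V_sub_L L_add by (auto simp: tile_def)
    then show "k + x \<in> tile s y (insert k I)" using x k by (auto simp: tile_def c lexpos_def)
  qed
  ultimately have "tile s y (insert k I) = tile s y I \<union> (+) k ` tile s y (insert k I)"
    by (auto simp: tile_def)
  moreover have "tile s y I \<inter> (+) k ` tile s y (insert k I) = {}"
    using k by (auto simp: tile_def c)
  moreover have "(+) k ` tile s y (insert k I) \<subseteq> L \<inter> pcone"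
    using tile_subset[OF s] \<open>(+) k ` _ \<subseteq> _\<close> by blast
  ultimately have "hilbert_series (tile s y (insert k I)) =
      hilbert_series (tile s y I) + hilbert_series ((+) k ` tile s y (insert k I))"
    using hilbert_series_Un[OF tile_subset[OF s]] by metis
  then show ?thesis using hilbert_series_shift[OF tile_subset[OF s] kV] by metis
qed

lemma hilbert_series_tile:
  assumes "s \<in> bases"
  shows "(1 - fps_X) ^ DIM('a) * hilbert_series (tile s y s) = hilbert_series (tile s y {})"
proof -
  have "(1 - fps_X) ^ card I * hilbert_series (tile s y I) = hilbert_series (tile s y {})"
    if "finite I" "I \<subseteq> s" for I
    using that
  proof (induction I rule: finite_induct)
    case (insert k I)
    have "(1 - fps_X) * hilbert_series (tile s y (insert k I)) = hilbert_series (tile s y I)"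
      using tile_insert[OF assms, of k I y] insert by (simp add: algebra_simps)
    moreover have "(1 - fps_X) ^ card (insert k I) * hilbert_series (tile s y (insert k I)) =
        (1 - fps_X) ^ card I * ((1 - fps_X) * hilbert_series (tile s y (insert k I)))"
      unfolding card_insert_disjoint[OF insert.hyps] by (simp only: power_Suc2 mult.assoc)
    ultimately show ?case using insert.IH insert.prems by (simp del: power_Suc)
  qed simp
  from this[of s] show ?thesis using basesD(4,5)[OF assms] by simp
qed

text \<open>For \<open>y\<close> in the cone, \<open>x + y\<close> lies in the cone together with
  \<open>x\<close>, so every lattice point of the cone falls into exactly one half-open
  cell.\<close>

lemma hilbert_series_cone:
  assumes w: "\<forall>s\<in>bases. \<forall>j\<in>V - s. reduced_cost w s j \<noteq> 0"
    and y: "generic y" "y \<in> pcone"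
  shows "(1 - fps_X) ^ DIM('a) * hilbert_series (L \<inter> pcone) =
    (\<Sum>s\<in>optimal_bases w. hilbert_series (tile s y {}))"
proof -
  have fin: "finite (optimal_bases w)" and opt: "\<And>s. s \<in> optimal_bases w \<Longrightarrow> s \<in> bases"
    using finite_bases by (auto simp: optimal_bases_def)
  have uniq: "\<exists>!s. s \<in> optimal_bases w \<and> (\<forall>i\<in>s. lexpos (coord s x i) (coord s y i))"
    if "x \<in> pcone" for x
    using half_open_decomposition[OF w y(1) that, of 1] that y(2) cone_add by auto
  have "hilbert_series (L \<inter> pcone) = (\<Sum>s\<in>optimal_bases w. hilbert_series (tile s y s))"
  proof (rule fps_ext)
    fix m
    have "{x \<in> L \<inter> pcone. ht x = real m} =
        (\<Union>s\<in>optimal_bases w. {x \<in> tile s y s. ht x = real m})"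
    proof (intro equalityI subsetI)
      fix x assume "x \<in> {x \<in> L \<inter> pcone. ht x = real m}"
      then show "x \<in> (\<Union>s\<in>optimal_bases w. {x \<in> tile s y s. ht x = real m})"
        using uniq[of x] by (auto simp: tile_def)
    qed (use tile_subset opt in blast)
    also have "card \<dots> = (\<Sum>s\<in>optimal_bases w. card {x \<in> tile s y s. ht x = real m})"
    proof (rule card_UN_disjoint[OF fin])
      show "\<forall>s\<in>optimal_bases w. finite {x \<in> tile s y s. ht x = real m}"
        using tile_subset opt finite_level_subset by blast
      show "\<forall>s\<in>optimal_bases w. \<forall>s'\<in>optimal_bases w. s \<noteq> s' \<longrightarrow>
          {x \<in> tile s y s. ht x = real m} \<inter> {x \<in> tile s' y s'. ht x = real m} = {}"
      proof (intro ballI impI)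
        fix s s' assume s: "s \<in> optimal_bases w" "s' \<in> optimal_bases w" "s \<noteq> s'"
        have False if x: "x \<in> tile s y s" "x \<in> tile s' y s'" for x
        proof -
          have "x \<in> pcone" using tile_subset opt s(1) x(1) by blast
          from uniq[OF this] show False using s x by (auto simp: tile_def)
        qed
        then show "{x \<in> tile s y s. ht x = real m} \<inter> {x \<in> tile s' y s'. ht x = real m} = {}" by auto
      qed
    qed
    finally show "fps_nth (hilbert_series (L \<inter> pcone)) m =
        fps_nth (\<Sum>s\<in>optimal_bases w. hilbert_series (tile s y s)) m"
      by (simp add: hilbert_series_def fps_sum_nth)
  qed
  then show ?thesis using opt by (simp add: sum_distrib_left hilbert_series_tile)
qed

text \<open>The coefficients of the numerator are sums of cardinalities, so a single point of height
  \<open>m\<close> already makes the coefficient at \<open>m\<close> positive.\<close>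

lemma height_le_degree:
  assumes w: "\<forall>s\<in>bases. \<forall>j\<in>V - s. reduced_cost w s j \<noteq> 0"
    and y: "generic y" "y \<in> pcone"
    and b: "s \<in> optimal_bases w" "b \<in> tile s y {}"
  shows "ht b \<le> real degree"
proof -
  have fin: "finite (optimal_bases w)" and opt: "\<And>s. s \<in> optimal_bases w \<Longrightarrow> s \<in> bases"
    using finite_bases by (auto simp: optimal_bases_def)
  have bLC: "b \<in> L \<inter> pcone" using tile_subset opt b by blast
  then obtain k where "ht b = of_int k" "ht b \<ge> 0"
    using ht_L ht_cone_nonneg by (metis IntE Ints_cases)
  then have m: "ht b = real (nat k)" by simp
  define m where "m = nat k"
  note m = m[folded m_def]
  let ?h = "(1 - fps_X) ^ DIM('a) * hilbert_series (L \<inter> pcone)"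
  have nth: "fps_nth ?h k = (\<Sum>s\<in>optimal_bases w. int (card {x \<in> tile s y {}. ht x = real k}))" for k
    unfolding hilbert_series_cone[OF w y] by (simp add: hilbert_series_def fps_sum_nth)
  have "finite {x \<in> tile s y {}. ht x = real m}" using tile_subset opt b finite_level_subset by blast
  then have "card {x \<in> tile s y {}. ht x = real m} > 0" using b m card_gt_0_iff by blast
  then have "int (card {x \<in> tile s y {}. ht x = real m}) > 0" by simp
  also have "int (card {x \<in> tile s y {}. ht x = real m}) \<le> fps_nth ?h m"
    unfolding nth using fin b by (intro member_le_sum) auto
  finally have 1: "fps_nth ?h m \<noteq> 0" by simp
  have height: "ht x \<le> DIM('a)" if "x \<in> tile s y {}" "s \<in> optimal_bases w" for s x
  proof -
    have "ht x = (\<Sum>i\<in>s. coord s x i)" using coord_ht opt that by blast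
    also have "\<dots> \<le> (\<Sum>i\<in>s. 1)"
      using that by (intro sum_mono) (auto simp: tile_def lexpos_def)
    also have "\<dots> = DIM('a)" using basesD(5) opt that by simp
    finally show ?thesis .
  qed
  \<comment> \<open>No parallelepiped has points above height \<open>DIM('a)\<close>, so the
    numerator is a polynomial and \<open>GREATEST\<close> is meaningful.\<close>
  have bound: "k \<le> DIM('a)" if k: "fps_nth ?h k \<noteq> 0" for k
  proof (rule ccontr)
    assume "\<not> k \<le> DIM('a)"
    then have "{x \<in> tile s y {}. ht x = real k} = {}" if "s \<in> optimal_bases w" for s
      using height[OF _ that] by force
    then have "card {x \<in> tile s y {}. ht x = real k} = 0" if "s \<in> optimal_bases w" for s
      by (simp only: that card.empty)
    then have "fps_nth ?h k = 0" unfolding nth by simp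
    then show False using k by simp
  qed
  have "m \<le> degree" unfolding degree_def by (rule Greatest_le_nat[where b = "DIM('a)"]) (use 1 bound in auto)
  then show ?thesis using m by simp
qed

text \<open>An order unit of the cone is an interior point, so this is the inequality
  \<open>codegree + degree \<ge> dimension + 1\<close> of Ehrhart theory. If \<open>x - \<epsilon> y\<close> lies in the simplicial cone
  over \<open>s\<close>, then the representative of \<open>- x\<close> in the half-open parallelepiped of \<open>s\<close> has height at
  least \<open>DIM('a) - ht x\<close>.\<close>

lemma order_unit_height:
  assumes x: "x \<in> L \<inter> pcone" and unit: "\<And>z. \<exists>N>0. N *\<^sub>R x - z \<in> pcone"
  shows "real DIM('a) \<le> ht x + real degree"
proof -
  obtain w where w: "\<forall>s\<in>bases. \<forall>j\<in>V - s. reduced_cost w s j \<noteq> 0"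
    using generic_weights_exist by blast
  obtain y where y: "y \<in> pcone" "generic y" using generic_vector_exists by blast
  obtain N where N: "N > 0" "N *\<^sub>R x - y \<in> pcone" using unit by blast
  have "(1 / N) *\<^sub>R (N *\<^sub>R x - y) \<in> pcone" using N by (intro cone_scale) auto
  then have "x + (1 / N) *\<^sub>R (- y) \<in> pcone" using N by (simp add: algebra_simps)
  \<comment> \<open>The cell is chosen for the direction \<open>- y\<close>, but the representative
    of \<open>- x\<close> is taken in the parallelepiped opened in direction \<open>y\<close>:
    negation exchanges the two.\<close>
  moreover have "generic (- y)" using y(2) by (auto simp: generic_def coord_minus)
  ultimately obtain s where s: "s \<in> optimal_bases w"
    "\<And>i. i \<in> s \<Longrightarrow> lexpos (coord s x i) (coord s (- y) i)"
    using half_open_decomposition[OF w, of "- y" x "1 / N"] x N by auto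
  have sb: "s \<in> bases" using s(1) by (simp add: optimal_bases_def)
  note b = basesD[OF sb]
  \<comment> \<open>The integer that puts \<open>n i - coord s x i\<close> into
    \<open>[0, 1)\<close> if \<open>y\<close> has a positive coordinate and into
    \<open>(0, 1]\<close> otherwise, as \<open>tile\<close> demands.\<close>
  define n where "n i = (if coord s y i > 0 then \<lceil>coord s x i\<rceil> else \<lfloor>coord s x i\<rfloor> + 1)" for i
  define p where "p = (\<Sum>i\<in>s. of_int (n i) *\<^sub>R i) - x"
  have p: "coord s p i = of_int (n i) - coord s x i" if "i \<in> s" for i
    using that by (simp add: p_def coord_diff coord_comb sb)
  have "p \<in> L" unfolding p_def using x b(1) V_sub_L by (intro L_diff L_sum L_scale) auto
  moreover have "lexpos (coord s p i) (coord s y i) \<and> \<not> lexpos (coord s p i - 1) (coord s y i)"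
    if "i \<in> s" for i
  proof (cases "coord s y i > 0")
    case True
    then have "0 \<le> coord s p i" "coord s p i < 1"
      using p[OF that] by (simp_all add: n_def) linarith
    with True show ?thesis by (auto simp: lexpos_def)
  next
    case False
    then have "0 < coord s p i" "coord s p i \<le> 1"
      using p[OF that] by (simp_all add: n_def)
    with False show ?thesis by (auto simp: lexpos_def)
  qed
  ultimately have "p \<in> tile s y {}" by (auto simp: tile_def)
  then have "ht p \<le> real degree" using height_le_degree[OF w y(2,1) s(1)] by simp
  moreover have "ht p = (\<Sum>i\<in>s. of_int (n i)) - ht x"
    using b(1) by (auto simp: p_def ht_sum ht_V intro!: sum.cong)
  \<comment> \<open>Where \<open>y\<close> has a positive coordinate, that of \<open>x\<close> is
    positive and rounded up; elsewhere it is nonnegative and 1 is added to its floor. Either way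
    \<open>n i\<close> is at least 1.\<close>
  moreover have "(\<Sum>i\<in>s. real_of_int (n i)) \<ge> (\<Sum>i\<in>s. 1)"
  proof (rule sum_mono)
    fix i assume "i \<in> s"
    then have "lexpos (coord s x i) (- coord s y i)" using s(2) by (simp add: coord_minus sb)
    then have "n i \<ge> 1" by (auto simp: n_def lexpos_def)
    then show "1 \<le> real_of_int (n i)" by simp
  qed
  ultimately show ?thesis using b(5) by simp
qed

section \<open>Faces of the cone\<close>

text \<open>The linear hull of the smallest face of the cone containing \<open>w\<close>, described by the order that
  the cone induces.\<close>

definition face_span :: "'a \<Rightarrow> 'a set" where
  "face_span w = {z. \<exists>N\<ge>0. N *\<^sub>R w - z \<in> pcone \<and> N *\<^sub>R w + z \<in> pcone}"

lemma face_span_subspace: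
  assumes "w \<in> pcone"
  shows "subspace (face_span w)"
proof (rule subspaceI)
  show "0 \<in> face_span w" unfolding face_span_def by (auto intro: exI[of _ 0])
next
  fix x y assume "x \<in> face_span w" "y \<in> face_span w"
  then obtain M N where "M \<ge> 0" "M *\<^sub>R w - x \<in> pcone" "M *\<^sub>R w + x \<in> pcone"
      "N \<ge> 0" "N *\<^sub>R w - y \<in> pcone" "N *\<^sub>R w + y \<in> pcone"
    unfolding face_span_def by blast
  moreover have "(M + N) *\<^sub>R w - (x + y) = (M *\<^sub>R w - x) + (N *\<^sub>R w - y)"
    "(M + N) *\<^sub>R w + (x + y) = (M *\<^sub>R w + x) + (N *\<^sub>R w + y)"
    by (simp_all add: algebra_simps)
  ultimately show "x + y \<in> face_span w"
    unfolding face_span_def by (intro CollectI exI[of _ "M + N"]) (metis add_nonneg_nonneg cone_add)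
next
  fix c x assume "x \<in> face_span w"
  then obtain N where N: "N \<ge> 0" "N *\<^sub>R w - x \<in> pcone" "N *\<^sub>R w + x \<in> pcone"
    unfolding face_span_def by blast
  have "\<bar>c\<bar> *\<^sub>R (N *\<^sub>R w - x) \<in> pcone" "\<bar>c\<bar> *\<^sub>R (N *\<^sub>R w + x) \<in> pcone"
    using N by (auto intro: cone_scale)
  then have "(\<bar>c\<bar> * N) *\<^sub>R w - \<bar>c\<bar> *\<^sub>R x \<in> pcone" "(\<bar>c\<bar> * N) *\<^sub>R w + \<bar>c\<bar> *\<^sub>R x \<in> pcone"
    by (simp_all add: scaleR_right_diff_distrib scaleR_right_distrib)
  then have "(\<bar>c\<bar> * N) *\<^sub>R w - c *\<^sub>R x \<in> pcone \<and> (\<bar>c\<bar> * N) *\<^sub>R w + c *\<^sub>R x \<in> pcone"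
    by (cases "c \<ge> 0") simp_all
  moreover have "\<bar>c\<bar> * N \<ge> 0" using N(1) by simp
  ultimately show "c *\<^sub>R x \<in> face_span w" unfolding face_span_def by blast
qed

lemma face_span_mono:
  assumes "w' - w \<in> pcone"
  shows "face_span w \<subseteq> face_span w'"
proof
  fix z assume "z \<in> face_span w"
  then obtain N where N: "N \<ge> 0" "N *\<^sub>R w - z \<in> pcone" "N *\<^sub>R w + z \<in> pcone"
    unfolding face_span_def by blast
  have "N *\<^sub>R (w' - w) \<in> pcone" using N(1) assms by (auto intro: cone_scale)
  from cone_add[OF this N(2)] cone_add[OF this N(3)]
  have "N *\<^sub>R w' - z \<in> pcone" "N *\<^sub>R w' + z \<in> pcone" by (simp_all add: algebra_simps)
  then show "z \<in> face_span w'" using N(1) unfolding face_span_def by blast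
qed

lemma face_span_below:
  assumes "w \<in> pcone" "u \<in> pcone" "N \<ge> 0" "N *\<^sub>R w - u \<in> pcone"
  shows "u \<in> face_span w"
  unfolding face_span_def using assms cone_add[OF cone_scale[OF assms(1,3)] assms(2)]
  by (intro CollectI exI[of _ N]) simp

lemma face_span_summand:
  assumes "u \<in> pcone" "w - u \<in> pcone"
  shows "u \<in> face_span w"
  using face_span_below[of w u 1] assms cone_add[OF assms(2,1)] by simp

lemma face_span_scaled_summand:
  assumes "u \<in> pcone" "w - c *\<^sub>R u \<in> pcone" "c > 0"
  shows "u \<in> face_span w"
proof -
  have *: "c *\<^sub>R u \<in> pcone" using assms by (auto intro: cone_scale)
  have "w \<in> pcone" using cone_add[OF * assms(2)] by simp
  then have "(1 / c) *\<^sub>R (c *\<^sub>R u) \<in> face_span w"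
    using face_span_summand[OF * assms(2)] face_span_subspace subspace_scale by blast
  then show ?thesis using assms(3) by simp
qed

text \<open>A generator used with positive coefficient in an element below a multiple of
  \<open>w\<close> lies in the face itself, and any \<open>z\<close> of the face span is half the
  difference of two such elements.\<close>

lemma face_span_generators:
  assumes "w \<in> pcone"
  shows "span (V \<inter> face_span w) = face_span w"
proof
  have sub: "subspace (face_span w)" using assms by (rule face_span_subspace)
  show "span (V \<inter> face_span w) \<subseteq> face_span w" using sub by (intro span_minimal) auto
  show "face_span w \<subseteq> span (V \<inter> face_span w)"
  proof
    fix z assume "z \<in> face_span w"
    then obtain N where N: "N \<ge> 0" "N *\<^sub>R w - z \<in> pcone" "N *\<^sub>R w + z \<in> pcone"
      unfolding face_span_def by blast
    have in_span: "p \<in> span (V \<inter> face_span w)"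
      if p: "p \<in> pcone" "N' \<ge> 0" "N' *\<^sub>R w - p \<in> pcone" for p N'
    proof -
      obtain a where a: "\<forall>v\<in>V. a v \<ge> 0" "p = (\<Sum>v\<in>V. a v *\<^sub>R v)" using p(1) by (rule coneE)
      have "a v *\<^sub>R v \<in> span (V \<inter> face_span w)" if v: "v \<in> V" for v
      proof (cases "a v = 0")
        case False
        then have pos: "a v > 0" using a(1) v by force
        have "p - a v *\<^sub>R v = (\<Sum>u\<in>V - {v}. a u *\<^sub>R u)"
          unfolding a(2) using finite_V v by (simp add: sum_diff1)
        also have "\<dots> \<in> pcone" using a(1) by (intro coneI) auto
        finally have "(p - a v *\<^sub>R v) + (N' *\<^sub>R w - p) \<in> pcone" using p(3) by (rule cone_add)
        then have "N' *\<^sub>R w - a v *\<^sub>R v \<in> pcone" by simp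
        then have "a v *\<^sub>R v \<in> face_span w"
          using pos v assms p(2) by (intro face_span_below[of w _ N']) (auto intro: cone_scale cone_V)
        then have "(1 / a v) *\<^sub>R a v *\<^sub>R v \<in> face_span w" using sub subspace_scale by blast
        then have "v \<in> face_span w" using pos by simp
        then show ?thesis using v by (auto intro: span_base span_scale)
      qed (simp add: span_zero)
      then show ?thesis unfolding a(2) by (intro span_sum)
    qed
    \<comment> \<open>The two elements add up to \<open>(2 * N) *\<^sub>R w\<close>, so each lies
      below it.\<close>
    have *: "(2 * N) *\<^sub>R w - (N *\<^sub>R w - z) = N *\<^sub>R w + z" "(2 * N) *\<^sub>R w - (N *\<^sub>R w + z) = N *\<^sub>R w - z"
      by (simp_all add: algebra_simps flip: scaleR_left_distrib)
    have "N *\<^sub>R w - z \<in> span (V \<inter> face_span w)" "N *\<^sub>R w + z \<in> span (V \<inter> face_span w)"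
      using in_span[of "N *\<^sub>R w - z" "2 * N"] in_span[of "N *\<^sub>R w + z" "2 * N"] N unfolding * by simp_all
    then have "(1/2) *\<^sub>R ((N *\<^sub>R w + z) - (N *\<^sub>R w - z)) \<in> span (V \<inter> face_span w)"
      by (metis span_scale span_diff)
    moreover have "(1/2) *\<^sub>R ((N *\<^sub>R w + z) - (N *\<^sub>R w - z)) = z"
      by (simp add: algebra_simps flip: scaleR_left_distrib)
    ultimately show "z \<in> span (V \<inter> face_span w)" by simp
  qed
qed

text \<open>\<open>E\<close> represents a basis of the quotient by \<open>span S\<close>. It serves
  to enlarge a face to the whole cone and to provide coordinates modulo a face.\<close>

lemma complete_by_generators:
  assumes "S \<subseteq> V"
  obtains E B0 where "B0 \<subseteq> S" "E \<subseteq> V" "B0 \<union> E \<in> bases" "B0 \<inter> E = {}" "span B0 = span S"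
    "card B0 = dim (span S)" "card E + dim (span S) = DIM('a)"
proof -
  obtain B0 where B0: "B0 \<subseteq> S" "independent B0" "S \<subseteq> span B0" "card B0 = dim S"
    using basis_exists by blast
  have sp: "span B0 = span S" using B0(1,3) span_mono[of B0 S] span_mono[of S "span B0"] unfolding span_span by blast
  obtain s where s: "B0 \<subseteq> s" "s \<in> bases" using extend_to_basis B0 assms by (metis subset_trans)
  have "card (s - B0) + card B0 = card s"
    using basesD(4)[OF s(2)] s(1) by (metis card_Diff_subset card_mono finite_subset le_add_diff_inverse2)
  then have "card (s - B0) + dim (span S) = DIM('a)" using B0(4) basesD(5)[OF s(2)] by simp
  moreover have "B0 \<union> (s - B0) \<in> bases" using s by (simp add: Un_absorb1)
  ultimately show ?thesis
    using that[of B0 "s - B0"] B0(1,4) sp basesD(1)[OF s(2)] by auto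
qed

text \<open>Adding generators that complete the face span turns \<open>w\<close> into an order unit.
  The height grows by the codimension, so \<open>order_unit_height\<close> becomes a bound on the
  dimension.\<close>

lemma dim_face_span_le:
  assumes "w \<in> L \<inter> pcone"
  shows "real (dim (face_span w)) \<le> ht w + real degree"
proof -
  have gen: "span (V \<inter> face_span w) = face_span w" using assms face_span_generators by blast
  obtain E B0 where B0: "B0 \<subseteq> V \<inter> face_span w" "B0 \<union> E \<in> bases" and E: "E \<subseteq> V"
    "card E + dim (face_span w) = DIM('a)"
    using complete_by_generators[of "V \<inter> face_span w"] gen by (metis Int_lower1)
  have fin: "finite E" using E(1) finite_V finite_subset by blast
  define x where "x = w + \<Sum>E"
  have sumE: "\<Sum>E \<in> pcone" "\<Sum>E \<in> L"
    using E(1) cone_V V_sub_L by (auto intro!: cone_sum L_sum)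
  then have xL: "x \<in> L \<inter> pcone" using assms by (auto simp: x_def intro: cone_add L_add)
  have subx: "subspace (face_span x)" using xL face_span_subspace by blast
  have "E \<subseteq> face_span x"
  proof
    fix e assume e: "e \<in> E"
    have "x - e = w + \<Sum>(E - {e})" using fin e by (simp add: x_def sum_diff1)
    also have "\<dots> \<in> pcone" using assms E(1) cone_V by (auto intro!: cone_add cone_sum)
    finally show "e \<in> face_span x" using e E(1) cone_V by (intro face_span_summand) auto
  qed
  moreover have "face_span w \<subseteq> face_span x"
    by (rule face_span_mono) (simp add: x_def sumE)
  ultimately have "span (B0 \<union> E) \<subseteq> face_span x" using B0(1) subx by (intro span_minimal) auto
  then have all: "z \<in> face_span x" for z using basesD(3)[OF B0(2)] by blast
  have "\<exists>N>0. N *\<^sub>R x - z \<in> pcone" for z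
  proof -
    obtain N where N: "N \<ge> 0" "N *\<^sub>R x - z \<in> pcone" using all[of z] unfolding face_span_def by blast
    \<comment> \<open>One more copy of \<open>x\<close> makes the multiplier positive, as
      \<open>N\<close> may be 0.\<close>
    have "(N *\<^sub>R x - z) + x \<in> pcone" using N(2) xL by (auto intro: cone_add)
    then have "(N + 1) *\<^sub>R x - z \<in> pcone" by (simp add: algebra_simps)
    then show ?thesis using N(1) by (intro exI[of _ "N + 1"]) auto
  qed
  then have "real DIM('a) \<le> ht x + real degree" using order_unit_height[OF xL] by blast
  moreover have "ht x = ht w + card E"
  proof -
    have "ht (\<Sum>E) = (\<Sum>e\<in>E. 1)" unfolding ht_sum using E(1) ht_V by (intro sum.cong) auto
    then show ?thesis by (simp add: x_def)
  qed
  ultimately show ?thesis using E(2) by linarith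
qed

section \<open>Fundamental parallelepipeds and non-integral coordinates\<close>

definition frac_part :: "'a set \<Rightarrow> 'a \<Rightarrow> 'a" where
  "frac_part s x = x - (\<Sum>i\<in>s. of_int \<lfloor>coord s x i\<rfloor> *\<^sub>R i)"

lemma coord_frac_part:
  assumes "s \<in> bases" "i \<in> s"
  shows "coord s (frac_part s x) i = frac (coord s x i)"
  unfolding frac_part_def coord_diff[OF assms(1)] coord_comb[OF assms] frac_def ..

lemma frac_part_L:
  assumes "s \<in> bases" "x \<in> L"
  shows "frac_part s x \<in> L"
  unfolding frac_part_def using assms basesD(1)[OF assms(1)] V_sub_L
  by (intro L_diff L_sum L_scale) auto

text \<open>Basis vectors with positive coordinate lie below a multiple of \<open>y\<close>, hence
  in its face, where their independence bounds their number by the dimension.\<close>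

lemma card_support_le:
  assumes s: "s \<in> bases" and y: "y \<in> L" "\<And>i. i \<in> s \<Longrightarrow> coord s y i \<ge> 0"
  shows "real (card {i\<in>s. coord s y i > 0}) \<le> ht y + real degree"
proof -
  have yc: "y \<in> pcone" using basis_in_cone s y(2) by blast
  have "{i\<in>s. coord s y i > 0} \<subseteq> face_span y"
  proof
    fix i assume i: "i \<in> {i\<in>s. coord s y i > 0}"
    have "y - coord s y i *\<^sub>R i \<in> pcone"
      by (rule basis_in_cone[OF s]) (use i y(2) in \<open>auto simp: coord_diff coord_scale coord_basis s\<close>)
    then show "i \<in> face_span y"
      using i basesD(1)[OF s] cone_V by (intro face_span_scaled_summand[of _ _ "coord s y i"]) auto
  qed
  moreover have "independent {i\<in>s. coord s y i > 0}"
    using basesD(2)[OF s] by (rule independent_mono) auto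
  ultimately have "card {i\<in>s. coord s y i > 0} \<le> dim (face_span y)"
    by (rule independent_card_le_dim)
  then show ?thesis using dim_face_span_le[of y] y(1) yc by simp
qed

text \<open>Both a point of the fundamental parallelepiped and its negative, reduced to the
  parallelepiped, satisfy \<open>card_support_le\<close>; their heights add up to the size of the support.\<close>

lemma card_nonintegral_le:
  assumes s: "s \<in> bases" and x: "x \<in> L"
  shows "card {i\<in>s. coord s x i \<notin> \<int>} \<le> 2 * degree"
proof -
  note b = basesD[OF s]
  define I where "I = {i\<in>s. coord s x i \<notin> \<int>}"
  define y where "y = frac_part s x"
  define y' where "y' = \<Sum>I - y"
  have IV: "I \<subseteq> V" using b by (auto simp: I_def)
  have cy: "coord s y i = frac (coord s x i)" if "i \<in> s" for i
    using coord_frac_part[OF s that] by (simp add: y_def)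
  have cI: "coord s (\<Sum>I) i = (if i \<in> I then 1 else 0)" if "i \<in> s" for i
  proof -
    have "coord s (\<Sum>I) i = (\<Sum>j\<in>I. if i = j then 1 else 0)"
      using s by (auto simp: coord_sum I_def coord_basis intro!: sum.cong)
    then show ?thesis using b(4) by (simp add: I_def)
  qed
  have cy': "coord s y' i = (if i \<in> I then 1 - frac (coord s x i) else 0)" if "i \<in> s" for i
  proof -
    have "i \<notin> I \<Longrightarrow> frac (coord s x i) = 0" using that by (simp add: I_def frac_eq_0_iff)
    then show ?thesis using that by (simp add: y'_def coord_diff s cI cy)
  qed
  have yL: "y \<in> L" unfolding y_def using frac_part_L[OF s x] .
  have y'L: "y' \<in> L" unfolding y'_def using yL IV V_sub_L by (intro L_diff L_sum) auto
  have "ht (\<Sum>I) = real (card I)"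
  proof -
    have "ht (\<Sum>I) = (\<Sum>i\<in>I. 1)" unfolding ht_sum using IV ht_V by (intro sum.cong) auto
    then show ?thesis by simp
  qed
  then have h: "ht y' = real (card I) - ht y" by (simp add: y'_def)
  have "{i\<in>s. coord s y i > 0} = I"
    using cy frac_gt_0_iff by (auto simp: I_def)
  then have 1: "real (card I) \<le> ht y + real degree"
    using card_support_le[OF s yL] cy by simp
  have "{i\<in>s. coord s y' i > 0} = I"
    using cy' frac_lt_1 by (auto simp: I_def split: if_splits)
  moreover have "coord s y' i \<ge> 0" if "i \<in> s" for i
    using cy'[OF that] frac_lt_1[of "coord s x i"] by simp
  ultimately have "real (card I) \<le> ht y' + real degree"
    using card_support_le[OF s y'L] by simp
  with 1 h show ?thesis by (simp add: I_def)
qed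

text \<open>Double counting over \<open>G\<close>, which represents the quotient of \<open>L\<close>
  by the sublattice generated by \<open>s\<close>. Each coordinate that is somewhere fractional is
  nonzero on at least half of \<open>G\<close>, whereas a point of \<open>G\<close> has at most
  \<open>2 * degree\<close> nonzero coordinates.\<close>

lemma card_nonintegral_coords:
  assumes s: "s \<in> bases" and d: "degree \<ge> 1"
  shows "card {i\<in>s. \<exists>x\<in>L. coord s x i \<notin> \<int>} < 4 * degree"
proof -
  note b = basesD[OF s]
  define G where "G = {x\<in>L. \<forall>i\<in>s. 0 \<le> coord s x i \<and> coord s x i < 1}"
  define N where "N = {i\<in>s. \<exists>x\<in>L. coord s x i \<notin> \<int>}"
  have finN: "finite N" using b by (simp add: N_def)
  have "norm x \<le> (\<Sum>i\<in>s. norm i)" if "x \<in> G" for x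
  proof -
    have "norm (\<Sum>i\<in>s. coord s x i *\<^sub>R i) \<le> (\<Sum>i\<in>s. norm i)"
    proof (rule sum_norm_le)
      fix i assume "i \<in> s"
      then have "\<bar>coord s x i\<bar> \<le> 1" using that by (auto simp: G_def)
      then show "norm (coord s x i *\<^sub>R i) \<le> norm i" by (simp add: mult_left_le_one_le)
    qed
    then show ?thesis by (simp add: coord_eq s)
  qed
  then have "bounded G" by (rule boundedI)
  then have finG: "finite G" using finite_L_bounded[of G] by (simp add: G_def Int_absorb1)
  have G_frac: "frac_part s x \<in> G" if "x \<in> L" for x
    using that frac_part_L[OF s] by (auto simp: G_def coord_frac_part s frac_lt_1)
  have G0: "0 \<in> G" using L_0 by (auto simp: G_def real_vector.representation_zero)
  \<comment> \<open>Translation by a point with fractional \<open>i\<close>-th coordinate maps the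
    points where this coordinate is 0 injectively to points where it is not.\<close>
  have half: "card G \<le> 2 * card {g\<in>G. coord s g i \<noteq> 0}" if i: "i \<in> N" for i
  proof -
    obtain x0 where x0: "x0 \<in> L" "coord s x0 i \<notin> \<int>" "i \<in> s" using i by (auto simp: N_def)
    define f where "f g = frac_part s (g + x0)" for g
    have "inj_on f {g\<in>G. coord s g i = 0}"
    proof (rule inj_onI)
      fix g g' assume g: "g \<in> {g\<in>G. coord s g i = 0}" "g' \<in> {g\<in>G. coord s g i = 0}" "f g = f g'"
      show "g = g'"
      proof (rule coord_eqI[OF s])
        fix j assume j: "j \<in> s"
        have "frac (coord s g j + coord s x0 j) = frac (coord s g' j + coord s x0 j)"
          using arg_cong[OF g(3), of "\<lambda>x. coord s x j"] j by (simp add: f_def coord_frac_part s coord_add)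
        then have "coord s g j - coord s g' j = of_int (\<lfloor>coord s g j + coord s x0 j\<rfloor> - \<lfloor>coord s g' j + coord s x0 j\<rfloor>)"
          by (simp add: frac_def)
        then obtain k :: int where k: "coord s g j - coord s g' j = of_int k" by blast
        moreover have "0 \<le> coord s g j" "coord s g j < 1" "0 \<le> coord s g' j" "coord s g' j < 1"
          using g(1,2) j by (auto simp: G_def)
        ultimately have "of_int k < (1::real)" "of_int k > (-1::real)" by linarith+
        then have "k = 0" by linarith
        then show "coord s g j = coord s g' j" using k by simp
      qed
    qed
    moreover have "f ` {g\<in>G. coord s g i = 0} \<subseteq> {g\<in>G. coord s g i \<noteq> 0}"
      using x0 G_frac L_add by (auto simp: f_def coord_frac_part s coord_add frac_eq_0_iff G_def frac_lt_1)
    ultimately have "card {g\<in>G. coord s g i = 0} \<le> card {g\<in>G. coord s g i \<noteq> 0}"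
      using finG by (intro card_inj_on_le) auto
    moreover have "card G = card {g\<in>G. coord s g i = 0} + card {g\<in>G. coord s g i \<noteq> 0}"
      using finG by (subst card_Un_disjoint[symmetric]) (auto intro: arg_cong[of _ _ card])
    ultimately show ?thesis by linarith
  qed
  have supp: "card {i\<in>N. coord s g i \<noteq> 0} \<le> 2 * degree" if "g \<in> G" for g
  proof -
    have "{i\<in>N. coord s g i \<noteq> 0} \<subseteq> {i\<in>s. coord s g i \<notin> \<int>}"
    proof
      fix i assume i: "i \<in> {i\<in>N. coord s g i \<noteq> 0}"
      then have "0 < coord s g i" "coord s g i < 1" "i \<in> s" using that by (force simp: G_def N_def)+
      then have "frac (coord s g i) \<noteq> 0" by (simp add: frac_eq)
      then show "i \<in> {i\<in>s. coord s g i \<notin> \<int>}" using \<open>i \<in> s\<close> by (simp add: frac_eq_0_iff)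
    qed
    then have "card {i\<in>N. coord s g i \<noteq> 0} \<le> card {i\<in>s. coord s g i \<notin> \<int>}"
      using b(4) by (intro card_mono) auto
    then show ?thesis using card_nonintegral_le[OF s, of g] that by (simp add: G_def)
  qed
  have "card N * card G = (\<Sum>i\<in>N. card G)" by simp
  also have "\<dots> \<le> (\<Sum>i\<in>N. 2 * card {g\<in>G. coord s g i \<noteq> 0})" by (intro sum_mono half)
  also have "\<dots> = 2 * (\<Sum>i\<in>N. \<Sum>g\<in>G. if coord s g i \<noteq> 0 then 1 else 0)"
    using finG by (simp add: sum_distrib_left sum.If_cases Int_def)
  also have "\<dots> = 2 * (\<Sum>g\<in>G. \<Sum>i\<in>N. if coord s g i \<noteq> 0 then 1 else 0)"
    by (subst sum.swap) simp
  also have "\<dots> = 2 * (\<Sum>g\<in>G. card {i\<in>N. coord s g i \<noteq> 0})"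
    using finN by (simp add: sum.If_cases Int_def)
  \<comment> \<open>The origin has no nonzero coordinate; leaving it out makes the final inequality
    strict.\<close>
  also have "(\<Sum>g\<in>G. card {i\<in>N. coord s g i \<noteq> 0}) = (\<Sum>g\<in>G - {0}. card {i\<in>N. coord s g i \<noteq> 0})"
    using finG by (intro sum.mono_neutral_right) (auto simp: real_vector.representation_zero)
  also have "\<dots> \<le> (\<Sum>g\<in>G - {0}. 2 * degree)" by (intro sum_mono supp) auto
  also have "2 * \<dots> = 4 * degree * (card G - 1)" using G0 finG by simp
  finally have "card N * card G \<le> 4 * degree * (card G - 1)" by simp
  moreover have "card G \<ge> 1" using G0 finG card_gt_0_iff[of G] by (auto simp: Suc_le_eq)
  then have "4 * degree * (card G - 1) < 4 * degree * card G" using d by simp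
  ultimately have "card N * card G < 4 * degree * card G" by linarith
  then show ?thesis by (simp add: N_def)
qed

section \<open>Projection onto a unimodular simplex\<close>

lemma face_span_ideal:
  assumes "w \<in> pcone" "a \<in> pcone" "b \<in> pcone" "a + b \<in> face_span w"
  shows "a \<in> face_span w"
proof -
  obtain N where N: "N \<ge> 0" "N *\<^sub>R w - (a + b) \<in> pcone"
    using assms(4) unfolding face_span_def by blast
  have "N *\<^sub>R w - a \<in> pcone" using cone_add[OF N(2) assms(3)] by (simp add: algebra_simps)
  then show ?thesis using face_span_below N(1) assms by blast
qed

lemma face_span_summands:
  assumes F: "F \<subseteq> V" and u: "u \<in> pcone" and c: "\<And>e. e \<in> F \<Longrightarrow> c e > 0"
    and sum: "(\<Sum>e\<in>F. c e *\<^sub>R e) \<in> face_span u"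
  shows "F \<subseteq> face_span u"
proof
  fix e assume e: "e \<in> F"
  have fin: "finite F" using F finite_V finite_subset by blast
  have 1: "c e *\<^sub>R e \<in> pcone" using e F c by (intro cone_scale cone_V) (auto intro: less_imp_le)
  have 2: "(\<Sum>e\<in>F - {e}. c e *\<^sub>R e) \<in> pcone" using F c by (intro coneI) (auto intro: less_imp_le)
  have "c e *\<^sub>R e + (\<Sum>e\<in>F - {e}. c e *\<^sub>R e) \<in> face_span u"
    using sum sum.remove[OF fin e, of "\<lambda>e. c e *\<^sub>R e"] by simp
  then have "c e *\<^sub>R e \<in> face_span u" using face_span_ideal u 1 2 by blast
  then have "(1 / c e) *\<^sub>R c e *\<^sub>R e \<in> face_span u"
    using face_span_subspace[OF u] by (rule subspace_scale[rotated])
  then show "e \<in> face_span u" using c[OF e] by simp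
qed

text \<open>Packages what is needed of a set \<open>A\<close> of generators: its sum is a lattice
  point of height \<open>card A\<close>, the number that \<open>dim_face_span_le\<close> compares
  with the dimension of the face.\<close>

lemma face_span_sum:
  assumes "A \<subseteq> V"
  shows "\<Sum>A \<in> L \<inter> pcone" "ht (\<Sum>A) = card A" "A \<subseteq> face_span (\<Sum>A)"
    "A' \<subseteq> A \<Longrightarrow> face_span (\<Sum>A') \<subseteq> face_span (\<Sum>A)"
proof -
  have fin: "finite A" using assms finite_V finite_subset by blast
  have sub: "\<Sum>B \<in> pcone" if "B \<subseteq> A" for B using that assms cone_V by (auto intro: cone_sum)
  show "\<Sum>A \<in> L \<inter> pcone" using sub assms V_sub_L by (auto intro: L_sum)
  have "ht (\<Sum>A) = (\<Sum>v\<in>A. 1)" unfolding ht_sum using assms ht_V by (intro sum.cong) auto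
  then show "ht (\<Sum>A) = card A" by simp
  have diff: "\<Sum>A - \<Sum>B = \<Sum>(A - B)" if "B \<subseteq> A" for B
    using fin that by (simp add: sum_diff)
  show "A \<subseteq> face_span (\<Sum>A)"
  proof
    fix v assume v: "v \<in> A"
    have "\<Sum>A - v \<in> pcone" using diff[of "{v}"] v sub[of "A - {v}"] by simp
    then show "v \<in> face_span (\<Sum>A)" using v assms cone_V by (intro face_span_summand) auto
  qed
  show "A' \<subseteq> A \<Longrightarrow> face_span (\<Sum>A') \<subseteq> face_span (\<Sum>A)"
    using diff sub by (intro face_span_mono) auto
qed

text \<open>A face spanned by \<open>card A\<close> generators can have dimension up to \<open>card A + degree\<close>. Choose \<open>A\<close> so
  that the excess \<open>dim - card A\<close> cannot be increased by adding few generators. Modulo the span of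
  that face the cone is then simplicial: every generator is a nonnegative multiple of one member
  of a basis of the quotient.\<close>

lemma simplicial_quotient:
  obtains A B E where "A \<subseteq> V" "A \<noteq> {}" "A \<subseteq> span B" "B \<union> E \<in> bases" "B \<inter> E = {}"
    "2 * card B \<le> degree ^ 2 + 5 * degree + 2"
    "\<And>v e. v \<in> V \<Longrightarrow> e \<in> E \<Longrightarrow> coord (B \<union> E) v e \<ge> 0"
    "\<And>v e e'. v \<in> V \<Longrightarrow> e \<in> E \<Longrightarrow> e' \<in> E \<Longrightarrow> coord (B \<union> E) v e > 0 \<Longrightarrow> coord (B \<union> E) v e' > 0 \<Longrightarrow> e = e'"
proof -
  \<comment> \<open>\<open>f\<close> is a lower bound for the excess. A raise from \<open>j\<close>
    to \<open>j + 1\<close> may cost at most \<open>degree + 1 - j\<close> generators; the leading 1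
    is the single generator at the start.\<close>
  define P where "P f \<longleftrightarrow> (\<exists>A. A \<subseteq> V \<and> A \<noteq> {} \<and> f + card A \<le> dim (face_span (\<Sum>A)) \<and>
    card A \<le> 1 + (\<Sum>j<f. degree + 1 - j))" for f
  have dim_le: "dim (face_span (\<Sum>A)) \<le> card A + degree" if "A \<subseteq> V" for A
    using dim_face_span_le[OF face_span_sum(1)[OF that]] face_span_sum(2)[OF that] by simp
  have P_le: "f \<le> degree" if "P f" for f
  proof -
    obtain A where "A \<subseteq> V" "f + card A \<le> dim (face_span (\<Sum>A))" using \<open>P f\<close> unfolding P_def by blast
    then show ?thesis using dim_le[of A] by linarith
  qed
  have "P 0"
  proof -
    obtain v where v: "v \<in> V" using V_nonempty by blast
    then have "v \<in> face_span v" using face_span_sum(3)[of "{v}"] by simp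
    moreover have "v \<noteq> 0" using ht_V[OF v] by auto
    ultimately have "dim (face_span v) \<noteq> 0" by (metis dim_eq_0 singletonD subsetD)
    then have "1 \<le> dim (face_span v)" by linarith
    then show ?thesis unfolding P_def using v by (intro exI[of _ "{v}"]) auto
  qed
  define f where "f = (GREATEST f. P f)"
  have "P f" unfolding f_def using \<open>P 0\<close> P_le by (rule GreatestI_nat) auto
  have f_max: "\<not> P (Suc f)"
    using Greatest_le_nat[of P "Suc f" degree] P_le unfolding f_def by fastforce
  obtain A where A: "A \<subseteq> V" "A \<noteq> {}" "f + card A \<le> dim (face_span (\<Sum>A))"
    "card A \<le> 1 + (\<Sum>j<f. degree + 1 - j)" using \<open>P f\<close> unfolding P_def by blast
  define D where "D = face_span (\<Sum>A)"
  have gen: "span (V \<inter> D) = D" unfolding D_def using face_span_sum(1)[OF A(1)] face_span_generators by blast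
  obtain B E where BE: "B \<subseteq> V \<inter> D" "E \<subseteq> V" "B \<union> E \<in> bases" "B \<inter> E = {}" "span B = D" "card B = dim D"
    using complete_by_generators[of "V \<inter> D"] gen by (metis Int_lower1)
  let ?s = "B \<union> E"
  note b = basesD[OF BE(3)]
  \<comment> \<open>\<open>pos\<close> and \<open>neg\<close> are the two sides of the relation of
    \<open>v\<close> modulo \<open>D\<close>, namely \<open>v + n = p + z\<close> with
    \<open>z\<close> in \<open>D\<close>.\<close>
  have signs: "neg = {} \<and> card pos \<le> 1"
    if v: "v \<in> V" and neg: "neg = {e\<in>E. coord ?s v e < 0}" and pos: "pos = {e\<in>E. coord ?s v e > 0}"
    for v neg pos
  proof -
    define z where "z = (\<Sum>i\<in>B. coord ?s v i *\<^sub>R i)"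
    define p where "p = (\<Sum>e\<in>pos. coord ?s v e *\<^sub>R e)"
    define n where "n = (\<Sum>e\<in>neg. (- coord ?s v e) *\<^sub>R e)"
    have finE: "finite E" "finite B" using b by auto
    have pn: "pos \<subseteq> V" "neg \<subseteq> V" "finite pos" "finite neg" using BE(2) finE by (auto simp: pos neg)
    have zD: "z \<in> D" unfolding z_def BE(5)[symmetric] by (intro span_sum span_scale span_base)
    have "v = z + (\<Sum>e\<in>E. coord ?s v e *\<^sub>R e)"
      using coord_eq[OF BE(3), of v] BE(4) finE by (simp add: sum.union_disjoint z_def)
    also have "(\<Sum>e\<in>E. coord ?s v e *\<^sub>R e) = (\<Sum>e\<in>pos \<union> neg. coord ?s v e *\<^sub>R e)"
      using finE by (intro sum.mono_neutral_right) (auto simp: pos neg)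
    also have "\<dots> = p - n"
      using pn by (subst sum.union_disjoint) (auto simp: pos neg p_def n_def sum_negf)
    finally have eq: "v + n = p + z" by simp
    have pc: "(\<Sum>e\<in>F. coord ?s v e *\<^sub>R e) \<in> pcone" if "F \<subseteq> pos" for F
      using that pn by (intro coneI) (auto simp: pos)
    have nc: "(\<Sum>e\<in>F. (- coord ?s v e) *\<^sub>R e) \<in> pcone" if "F \<subseteq> neg" for F
      using that pn by (intro coneI) (auto simp: neg)
    have p_in: "pos \<subseteq> face_span u" if "u \<in> pcone" "p \<in> face_span u" for u
      by (rule face_span_summands[OF pn(1) that(1) _ that(2)[unfolded p_def]]) (simp add: pos)
    have n_in: "neg \<subseteq> face_span u" if "u \<in> pcone" "n \<in> face_span u" for u
      by (rule face_span_summands[OF pn(2) that(1) _ that(2)[unfolded n_def]]) (simp add: neg)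
    have dims: "card B + card pos + card neg \<le> dim (face_span (\<Sum>A'))"
      if A': "A \<subseteq> A'" "A' \<subseteq> V" "pos \<subseteq> face_span (\<Sum>A')" "neg \<subseteq> face_span (\<Sum>A')" for A'
    proof -
      have "B \<subseteq> face_span (\<Sum>A')" using BE(1) face_span_sum(4)[OF A'(2,1)] D_def by blast
      then have "card (B \<union> (pos \<union> neg)) \<le> dim (face_span (\<Sum>A'))"
        using A' by (intro independent_card_le_dim independent_mono[OF b(2)]) (auto simp: pos neg)
      moreover have "card (B \<union> (pos \<union> neg)) = card B + (card pos + card neg)"
        using BE(4) finE by (subst card_Un_disjoint, auto simp: pos neg) (subst card_Un_disjoint, auto)
      ultimately show ?thesis by simp
    qed
    \<comment> \<open>Two ways to enlarge \<open>A\<close>. With \<open>neg\<close> and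
      \<open>v\<close> the face span contains \<open>v + n\<close>, hence \<open>p\<close> and
      \<open>pos\<close>; with \<open>pos\<close> it contains \<open>p + z\<close>, hence
      \<open>n\<close> and \<open>neg\<close>. So both contain \<open>B\<close>, \<open>pos\<close>
      and \<open>neg\<close>.\<close>
    define A1 where "A1 = A \<union> neg \<union> {v}"
    define A2 where "A2 = A \<union> pos"
    have AV: "A1 \<subseteq> V" "A2 \<subseteq> V" using A(1) pn v by (auto simp: A1_def A2_def)
    have c1: "card A1 \<le> card A + card neg + 1"
      unfolding A1_def using card_Un_le[of A neg] card_Un_le[of "A \<union> neg" "{v}"] by simp
    have c2: "card A2 \<le> card A + card pos"
      unfolding A2_def by (rule card_Un_le)
    note f1 = face_span_sum[OF AV(1)] and f2 = face_span_sum[OF AV(2)]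
    have s1: "subspace (face_span (\<Sum>A1))" and s2: "subspace (face_span (\<Sum>A2))"
      using f1(1) f2(1) face_span_subspace by auto
    have D1: "D \<subseteq> face_span (\<Sum>A1)" "D \<subseteq> face_span (\<Sum>A2)"
      unfolding D_def using f1(4)[of A] f2(4)[of A] by (auto simp: A1_def A2_def)
    have neg1: "neg \<subseteq> face_span (\<Sum>A1)" and pos2: "pos \<subseteq> face_span (\<Sum>A2)" and v1: "v \<in> face_span (\<Sum>A1)"
      using f1(3) f2(3) by (auto simp: A1_def A2_def)
    have "n \<in> face_span (\<Sum>A1)" unfolding n_def
      using neg1 by (intro subspace_sum[OF s1] subspace_scale[OF s1]) auto
    then have "(v + n) - z \<in> face_span (\<Sum>A1)"
      using v1 zD D1 by (intro subspace_diff[OF s1] subspace_add[OF s1]) auto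
    then have pos1: "pos \<subseteq> face_span (\<Sum>A1)" using eq p_in f1(1) by simp
    have "p \<in> face_span (\<Sum>A2)" unfolding p_def
      using pos2 by (intro subspace_sum[OF s2] subspace_scale[OF s2]) auto
    then have "n + v \<in> face_span (\<Sum>A2)"
      using eq zD D1 subspace_add[OF s2, of p z] by (auto simp: add.commute)
    then have "n \<in> face_span (\<Sum>A2)"
      using nc[of neg] v f2(1) by (intro face_span_ideal[of _ n v]) (auto simp: n_def cone_V)
    then have neg2: "neg \<subseteq> face_span (\<Sum>A2)" using n_in f2(1) by blast
    have d1: "card B + card pos + card neg \<le> dim (face_span (\<Sum>A1))"
      using AV pos1 neg1 by (intro dims) (auto simp: A1_def)
    have d2: "card B + card pos + card neg \<le> dim (face_span (\<Sum>A2))"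
      using AV pos2 neg2 by (intro dims) (auto simp: A2_def)
    have fB: "f + card A \<le> card B" using A(3) BE(6) D_def by simp
    \<comment> \<open>The dimension bound for one enlargement limits the side that the other
      enlargement has to add.\<close>
    have n_le: "f + card neg \<le> degree" using d2 dim_le[OF AV(2)] c2 fB by linarith
    have p_le: "f + card pos \<le> degree + 1" using d1 dim_le[OF AV(1)] c1 fB by linarith
    have fd: "f \<le> degree" using P_le \<open>P f\<close> by blast
    \<comment> \<open>Adding \<open>pos\<close> costs at most \<open>degree + 1 - f\<close>
      generators and gains \<open>card neg\<close> in excess, so a nonempty \<open>neg\<close>
      contradicts the choice of \<open>f\<close>.\<close>
    have "card neg = 0"
    proof (rule ccontr)
      assume "card neg \<noteq> 0"
      then have "Suc f + card A2 \<le> dim (face_span (\<Sum>A2))" using d2 c2 fB by linarith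
      moreover have "card A2 \<le> 1 + (\<Sum>j<Suc f. degree + 1 - j)"
        using c2 A(4) p_le fd by simp
      ultimately have "P (Suc f)" unfolding P_def using AV(2) A(2) by (intro exI[of _ A2]) (auto simp: A2_def)
      then show False using f_max by blast
    qed
    \<comment> \<open>Adding \<open>neg\<close> and \<open>v\<close> also costs at most
      \<open>degree + 1 - f\<close>. The gain is only \<open>card pos - 1\<close>, because
      \<open>v\<close> itself has to be paid for.\<close>
    moreover have "card pos \<le> 1"
    proof (rule ccontr)
      assume "\<not> card pos \<le> 1"
      then have "Suc f + card A1 \<le> dim (face_span (\<Sum>A1))" using d1 c1 fB by linarith
      moreover have "card A1 \<le> 1 + (\<Sum>j<Suc f. degree + 1 - j)"
        using c1 A(4) n_le fd by simp
      ultimately have "P (Suc f)" unfolding P_def using AV(1) A(2) by (intro exI[of _ A1]) (auto simp: A1_def)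
      then show False using f_max by blast
    qed
    ultimately show ?thesis using pn by simp
  qed
  show ?thesis
  proof (rule that[of A B E])
    show "A \<subseteq> V" "A \<noteq> {}" "B \<union> E \<in> bases" "B \<inter> E = {}" using A BE by auto
    show "A \<subseteq> span B" unfolding BE(5) D_def using face_span_sum(3)[OF A(1)] .
    \<comment> \<open>The total cost of the raises is at most \<open>(d^2 + 3d)/2\<close>. The
      initial generator adds 1, and passing from \<open>card A\<close> to the dimension adds
      \<open>d\<close>.\<close>
    have "(\<Sum>j<f. degree + 1 - j) \<le> (\<Sum>j<degree. degree + 1 - j)"
      using P_le[OF \<open>P f\<close>] by (intro sum_mono2) auto
    also have "2 * (\<Sum>j<m. m + 1 - j) = m ^ 2 + 3 * m" for m :: nat
      by (induction m) (simp_all add: sum.lessThan_Suc_shift power2_eq_square del: sum.lessThan_Suc)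
    then have "2 * (\<Sum>j<degree. degree + 1 - j) = degree ^ 2 + 3 * degree" .
    finally have "2 * (\<Sum>j<f. degree + 1 - j) \<le> degree ^ 2 + 3 * degree" by simp
    then show "2 * card B \<le> degree ^ 2 + 5 * degree + 2"
      using A(4) dim_le[OF A(1)] BE(6) unfolding D_def by linarith
    show "coord (B \<union> E) v e \<ge> 0" if "v \<in> V" "e \<in> E" for v e
      using signs[OF that(1) refl refl] that(2) by (auto simp: not_less)
    show "e = e'" if "v \<in> V" "e \<in> E" "e' \<in> E" "coord (B \<union> E) v e > 0" "coord (B \<union> E) v e' > 0" for v e e'
    proof -
      have "finite {e \<in> E. coord (B \<union> E) v e > 0}" using b by simp
      then show ?thesis using signs[OF that(1) refl refl] that
        by (auto simp: card_le_Suc0_iff_eq)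
    qed
  qed
qed

text \<open>The functionals send \<open>v0\<close> to the origin, each \<open>m\<close> in
  \<open>M\<close> to its unit vector, and every generator to one of these. The constant is
  \<open>(d^2 + 5d + 2) + 2 * (4d - 1)\<close>, from \<open>card B\<close> and from the discarded
  fractional coordinates.\<close>

lemma zero_one_functionals:
  assumes d: "degree \<ge> 1"
  obtains M v0 u where "M \<subseteq> V" "v0 \<in> V" "\<And>m. m \<in> M \<Longrightarrow> linear (u m)"
    "\<And>m x. m \<in> M \<Longrightarrow> x \<in> L \<Longrightarrow> u m x \<in> \<int>"
    "\<And>m v. m \<in> M \<Longrightarrow> v \<in> V \<Longrightarrow> u m v = 0 \<or> u m v = (1::real)"
    "\<And>m m' v. m \<in> M \<Longrightarrow> m' \<in> M \<Longrightarrow> v \<in> V \<Longrightarrow> u m v \<noteq> 0 \<Longrightarrow> u m' v \<noteq> 0 \<Longrightarrow> m = m'"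
    "\<And>m m'. m \<in> M \<Longrightarrow> m' \<in> M \<Longrightarrow> u m m' = (if m = m' then 1 else 0)"
    "\<And>m. m \<in> M \<Longrightarrow> u m v0 = 0"
    "2 * DIM('a) \<le> 2 * card M + degree ^ 2 + 13 * degree"
proof -
  obtain A B E where AE: "A \<subseteq> V" "A \<noteq> {}" "A \<subseteq> span B" "B \<union> E \<in> bases" "B \<inter> E = {}"
    and cardB: "2 * card B \<le> degree ^ 2 + 5 * degree + 2"
    and nonneg: "\<And>v e. v \<in> V \<Longrightarrow> e \<in> E \<Longrightarrow> coord (B \<union> E) v e \<ge> 0"
    and single: "\<And>v e e'. v \<in> V \<Longrightarrow> e \<in> E \<Longrightarrow> e' \<in> E \<Longrightarrow> coord (B \<union> E) v e > 0 \<Longrightarrow>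
      coord (B \<union> E) v e' > 0 \<Longrightarrow> e = e'"
    using simplicial_quotient by metis
  let ?s = "B \<union> E"
  note b = basesD[OF AE(4)]
  have finBE: "finite B" "finite E" using b by auto
  \<comment> \<open>Replacing each \<open>e\<close> by a generator with the largest
    \<open>e\<close>-coordinate scales this coordinate to values in \<open>[0, 1]\<close> on
    \<open>V\<close>; an integral one can then only be 0 or 1.\<close>
  have "\<exists>m\<in>V. \<forall>v\<in>V. coord ?s v e \<le> coord ?s m e" for e
    using arg_min_if_finite[OF finite_V V_nonempty, of "\<lambda>v. - coord ?s v e"] by (meson neg_less_iff_less not_le)
  then obtain m where m: "\<And>e. m e \<in> V" "\<And>e v. v \<in> V \<Longrightarrow> coord ?s v e \<le> coord ?s (m e) e"
    by metis
  define c where "c e = coord ?s (m e) e" for e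
  have c_ge: "c e \<ge> 1" if "e \<in> E" for e
    using m(2)[of e e] b(1) that by (auto simp: c_def coord_basis AE(4))
  have m_off: "coord ?s (m e) e' = (if e = e' then c e else 0)" if "e \<in> E" "e' \<in> E" for e e'
  proof (cases "e = e'")
    case False
    then have "\<not> coord ?s (m e) e' > 0"
      using single[OF m(1) that] c_ge[OF that(1)] by (force simp: c_def)
    then show ?thesis using nonneg[OF m(1) that(2), of e] False by simp
  qed (simp add: c_def)
  have B_off: "coord ?s x e = 0" if "e \<in> E" "x \<in> span B" for x e
  proof (rule linear_eq_0_on_span[OF coord_linear[OF AE(4)] _ that(2)])
    fix y assume "y \<in> B"
    then show "coord ?s y e = 0" using that(1) AE(5) by (auto simp: coord_basis AE(4))
  qed
  have m_notB: "m e \<notin> B" if "e \<in> E" for e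
    using B_off[OF that span_base] m_off[OF that that] c_ge[OF that] by force
  have inj: "inj_on m E"
  proof (rule inj_onI)
    fix e e' assume e: "e \<in> E" "e' \<in> E" "m e = m e'"
    show "e = e'"
    proof (rule ccontr)
      assume "e \<noteq> e'"
      then have "coord ?s (m e) e' = 0" using m_off[OF e(1,2)] by simp
      then have "c e' = 0" unfolding c_def e(3) .
      then show False using c_ge[OF e(2)] by simp
    qed
  qed
  let ?t = "B \<union> m ` E"
  have t: "?t \<in> bases"
  proof (rule basesI)
    show "?t \<subseteq> V" using b(1) m(1) by auto
    have "e \<in> span ?t" if e: "e \<in> E" for e
    proof -
      have "m e = (\<Sum>i\<in>B. coord ?s (m e) i *\<^sub>R i) + (\<Sum>i\<in>E. coord ?s (m e) i *\<^sub>R i)"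
        using coord_eq[OF AE(4), of "m e"] AE(5) finBE by (simp add: sum.union_disjoint)
      also have "(\<Sum>i\<in>E. coord ?s (m e) i *\<^sub>R i) = (\<Sum>i\<in>E. if e = i then c e *\<^sub>R e else 0)"
        using m_off[OF e] by (intro sum.cong) auto
      also have "\<dots> = c e *\<^sub>R e" using finBE e by simp
      finally have "c e *\<^sub>R e = m e - (\<Sum>i\<in>B. coord ?s (m e) i *\<^sub>R i)" by (simp add: algebra_simps)
      moreover have "m e - (\<Sum>i\<in>B. coord ?s (m e) i *\<^sub>R i) \<in> span ?t"
        using e by (intro span_diff span_sum span_scale) (auto intro: span_base)
      ultimately have "(1 / c e) *\<^sub>R c e *\<^sub>R e \<in> span ?t" by (metis span_scale)
      then show ?thesis using c_ge[OF e] by simp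
    qed
    then have "?s \<subseteq> span ?t" by (auto intro: span_base)
    then show "span ?t = UNIV" using b(3) span_mono[of ?s "span ?t"] unfolding span_span by auto
    have "card ?t \<le> card B + card E"
      using card_Un_le[of B "m ` E"] card_image_le[OF finBE(2), of m] by linarith
    also have "\<dots> = card ?s" using AE(5) finBE by (simp add: card_Un_disjoint)
    finally show "card ?t \<le> DIM('a)" using b(5) by simp
  qed
  \<comment> \<open>Both sides are linear and agree on the new basis, as
    \<open>e\<close>-coordinates vanish on \<open>B\<close> and on \<open>m e'\<close> for every
    other \<open>e'\<close> in \<open>E\<close>.\<close>
  have ct: "coord ?t x (m e) = coord ?s x e / c e" if e: "e \<in> E" for x e
  proof (rule linear_eq_on[where B = ?t and f = "\<lambda>x. coord ?t x (m e)" and g = "\<lambda>x. coord ?s x e / c e"])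
    show "linear (\<lambda>x. coord ?t x (m e))" by (rule coord_linear[OF t])
    show "linear (\<lambda>x. coord ?s x e / c e)"
      by (intro linearI) (simp_all add: coord_add coord_scale AE(4) add_divide_distrib)
    show "x \<in> span ?t" using basesD(3)[OF t] by simp
    fix y assume y: "y \<in> ?t"
    show "coord ?t y (m e) = coord ?s y e / c e"
    proof (cases "y \<in> B")
      case True
      then show ?thesis using B_off[OF e span_base[OF True]] m_notB[OF e] by (auto simp: coord_basis[OF t y])
    next
      case False
      then obtain e' where e': "e' \<in> E" "y = m e'" using y by auto
      then have "m e = y \<longleftrightarrow> e = e'" using inj e by (auto dest: inj_onD)
      moreover have "coord ?s y e = (if e = e' then c e else 0)"
        using m_off[OF e'(1) e] e'(2) by auto
      ultimately show ?thesis using c_ge[OF e] coord_basis[OF t y, of "m e"] by auto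
    qed
  qed
  define M where "M = {i \<in> m ` E. \<forall>x\<in>L. coord ?t x i \<in> \<int>}"
  have M_E: "\<exists>e\<in>E. i = m e" if "i \<in> M" for i using that by (auto simp: M_def)
  \<comment> \<open>A generator inside \<open>span B\<close>, where all chosen coordinates vanish:
    it ensures that the vertex 0 of the simplex is attained.\<close>
  obtain v0 where v0: "v0 \<in> A" using AE(2) by blast
  show ?thesis
  proof (rule that[of M v0 "\<lambda>i x. coord ?t x i"])
    show "M \<subseteq> V" using m(1) by (auto simp: M_def)
    show "v0 \<in> V" using v0 AE(1) by auto
    show "linear (\<lambda>x. coord ?t x i)" for i by (rule coord_linear[OF t])
    show int: "coord ?t x i \<in> \<int>" if "i \<in> M" "x \<in> L" for i x using that by (simp add: M_def)
    show "coord ?t v i = 0 \<or> coord ?t v i = 1" if i: "i \<in> M" and v: "v \<in> V" for i v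
    proof -
      obtain e where e: "e \<in> E" "i = m e" using M_E i by blast
      have "0 \<le> coord ?t v i" "coord ?t v i \<le> 1"
        using ct[OF e(1), of v] e(2) nonneg[OF v e(1)] m(2)[OF v, of e] c_ge[OF e(1)] by (simp_all add: c_def)
      moreover obtain k :: int where "coord ?t v i = of_int k"
        using int[OF i] v V_sub_L by (metis Ints_cases subsetD)
      ultimately show ?thesis by force
    qed
    show "i = i'" if q: "i \<in> M" "i' \<in> M" "v \<in> V" "coord ?t v i \<noteq> 0" "coord ?t v i' \<noteq> 0" for i i' v
    proof -
      obtain e e' where e: "e \<in> E" "i = m e" "e' \<in> E" "i' = m e'" using M_E q(1,2) by blast
      then have "coord ?s v e \<noteq> 0" "coord ?s v e' \<noteq> 0" using ct q(4,5) by auto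
      then have "coord ?s v e > 0" "coord ?s v e' > 0" using nonneg[OF q(3)] e(1,3) by (auto simp: less_le)
      then have "e = e'" using single[OF q(3) e(1,3)] by blast
      then show ?thesis using e by simp
    qed
    show "coord ?t i' i = (if i = i' then 1 else 0)" if "i \<in> M" "i' \<in> M" for i i'
      using coord_basis[OF t, of i'] that by (auto simp: M_def)
    show "coord ?t v0 i = 0" if "i \<in> M" for i
      using M_E[OF that] ct B_off v0 AE(3) by auto
    have "m ` E \<subseteq> M \<union> {i\<in>?t. \<exists>x\<in>L. coord ?t x i \<notin> \<int>}" by (auto simp: M_def)
    then have "card (m ` E) \<le> card (M \<union> {i\<in>?t. \<exists>x\<in>L. coord ?t x i \<notin> \<int>})"
      using finBE by (intro card_mono) (auto simp: M_def)
    also have "\<dots> \<le> card M + card {i\<in>?t. \<exists>x\<in>L. coord ?t x i \<notin> \<int>}" by (rule card_Un_le)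
    finally have "card E < card M + 4 * degree"
      using card_nonintegral_coords[OF t d] card_image[OF inj] by linarith
    moreover have "DIM('a) = card B + card E" using b(5) AE(5) finBE by (simp add: card_Un_disjoint)
    ultimately show "2 * DIM('a) \<le> 2 * card M + degree ^ 2 + 13 * degree"
      using cardB by linarith
  qed
qed

end

section \<open>Unimodular coordinates\<close>

lemma lattice_points_simps [simp]:
  "x \<in> lattice_points \<Longrightarrow> x $ i \<in> \<int>" "0 \<in> lattice_points"
  "x \<in> lattice_points \<Longrightarrow> y \<in> lattice_points \<Longrightarrow> x + y \<in> lattice_points"
  "x \<in> lattice_points \<Longrightarrow> y \<in> lattice_points \<Longrightarrow> x - y \<in> lattice_points"
  "x \<in> lattice_points \<Longrightarrow> - x \<in> lattice_points"
  "c \<in> \<int> \<Longrightarrow> x \<in> lattice_points \<Longrightarrow> c *\<^sub>R x \<in> lattice_points"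
  "axis i 1 \<in> lattice_points"
  by (auto simp: lattice_points_def axis_def)

lemma lattice_points_sum:
  "(\<And>i. i \<in> A \<Longrightarrow> f i \<in> lattice_points) \<Longrightarrow> sum f A \<in> lattice_points"
  by (induction A rule: infinite_finite_induct) auto

section \<open>Bases of subgroups of the integer lattice\<close>

lemma subgroup_of_int_generator:
  fixes S :: "int set"
  assumes "0 \<in> S" and diff: "\<And>a b. a \<in> S \<Longrightarrow> b \<in> S \<Longrightarrow> a - b \<in> S"
  shows "\<exists>d\<in>S. \<forall>a\<in>S. d dvd a"
proof -
  have neg: "- a \<in> S" if "a \<in> S" for a using diff[OF assms(1) that] by simp
  have add: "a + b \<in> S" if "a \<in> S" "b \<in> S" for a b using diff[OF that(1) neg[OF that(2)]] by simp
  have mult_nat: "int k * a \<in> S" if "a \<in> S" for a k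
    by (induction k) (use assms(1) add that in \<open>auto simp: algebra_simps\<close>)
  have mult: "k * a \<in> S" if "a \<in> S" for a k :: int
  proof (cases k rule: int_cases2)
    case (nonneg n) then show ?thesis using mult_nat that by simp
  next
    case (nonpos n) then show ?thesis using neg[OF mult_nat[OF that]] by simp
  qed
  show ?thesis
  proof (cases "S \<subseteq> {0}")
    case True
    then show ?thesis using assms(1) by (intro bexI[of _ 0]) auto
  next
    case False
    then obtain a where a: "a \<in> S" "a \<noteq> 0" by blast
    then have "\<bar>a\<bar> \<in> S" "\<bar>a\<bar> > 0" using neg[OF a(1)] by (auto simp: abs_if)
    then have "\<exists>n. n > 0 \<and> int n \<in> S" by (intro exI[of _ "nat \<bar>a\<bar>"]) auto
    then obtain n where n: "n > 0" "int n \<in> S" and least: "\<And>m. m > 0 \<and> int m \<in> S \<Longrightarrow> n \<le> m"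
      using exists_least_iff[of "\<lambda>n. n > 0 \<and> int n \<in> S"] by (metis not_le)
    have "int n dvd b" if b: "b \<in> S" for b
    proof (rule ccontr)
      assume "\<not> int n dvd b"
      then have "b mod int n \<noteq> 0" by (simp add: dvd_eq_mod_eq_0)
      moreover have "b mod int n = b - (b div int n) * int n" by (simp add: minus_div_mult_eq_mod)
      then have "b mod int n \<in> S" using diff[OF b mult[OF n(2)]] by simp
      moreover have "0 \<le> b mod int n" "b mod int n < int n" using n(1) by auto
      ultimately show False using least[of "nat (b mod int n)"] by auto
    qed
    then show ?thesis using n(2) by blast
  qed
qed

definition int_span :: "'a::real_vector set \<Rightarrow> 'a set" where
  "int_span B = {x. \<exists>a. (\<forall>b\<in>B. a b \<in> \<int>) \<and> x = (\<Sum>b\<in>B. a b *\<^sub>R b)}"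

text \<open>Echelon form, by induction on the coordinates that may be nonzero: the
  \<open>i\<close>-th coordinates of \<open>K\<close> are the multiples of some \<open>d\<close>,
  and an element \<open>w\<close> attaining \<open>d\<close> splits off, leaving the subgroup where
  this coordinate vanishes.\<close>

lemma lattice_subgroup_basis:
  fixes K :: "(real^'n) set"
  assumes "finite I" "K \<subseteq> lattice_points" "0 \<in> K" "\<And>x y. x \<in> K \<Longrightarrow> y \<in> K \<Longrightarrow> x - y \<in> K"
    and "\<And>x i. x \<in> K \<Longrightarrow> i \<notin> I \<Longrightarrow> x $ i = 0"
  shows "\<exists>B\<subseteq>K. finite B \<and> independent B \<and> K \<subseteq> int_span B"
  using assms
proof (induction I arbitrary: K rule: finite_induct)
  case empty
  then have "K = {0}" by (auto simp: vec_eq_iff)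
  then show ?case by (intro exI[of _ "{}"]) (auto simp: int_span_def independent_empty)
next
  case (insert i I)
  define K' where "K' = {x\<in>K. x $ i = 0}"
  have "\<exists>B\<subseteq>K'. finite B \<and> independent B \<and> K' \<subseteq> int_span B"
  proof (rule insert.IH)
    show "x $ j = 0" if "x \<in> K'" "j \<notin> I" for x j
      using that insert.prems(4) by (cases "j = i") (auto simp: K'_def)
  qed (use insert.prems in \<open>auto simp: K'_def\<close>)
  then obtain B where B: "B \<subseteq> K'" "finite B" "independent B" "K' \<subseteq> int_span B" by blast
  define S where "S = {k::int. \<exists>x\<in>K. x $ i = of_int k}"
  have "\<exists>d\<in>S. \<forall>a\<in>S. d dvd a"
  proof (rule subgroup_of_int_generator)
    show "0 \<in> S" using insert.prems(2) by (auto simp: S_def intro!: bexI[of _ 0])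
    fix a b assume "a \<in> S" "b \<in> S"
    then obtain x y where "x \<in> K" "y \<in> K" "x $ i = of_int a" "y $ i = of_int b" by (auto simp: S_def)
    then show "a - b \<in> S" using insert.prems(3)[of x y] by (auto simp: S_def intro!: bexI[of _ "x - y"])
  qed
  then obtain w d where w: "w \<in> K" "w $ i = of_int d" and d: "\<And>a. a \<in> S \<Longrightarrow> d dvd a"
    by (auto simp: S_def)
  have neg: "- x \<in> K" if "x \<in> K" for x using insert.prems(3)[OF insert.prems(2) that] by simp
  have add: "x + y \<in> K" if "x \<in> K" "y \<in> K" for x y using insert.prems(3)[OF that(1) neg[OF that(2)]] by simp
  have nmult: "of_nat k *\<^sub>R w \<in> K" for k
    by (induction k) (use insert.prems(2) add w in \<open>auto simp: algebra_simps\<close>)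
  have mult: "of_int k *\<^sub>R w \<in> K" for k
  proof (cases k rule: int_cases2)
    case (nonneg n) then show ?thesis using nmult[of n] by simp
  next
    case (nonpos n) then show ?thesis using neg[OF nmult[of n]] by simp
  qed
  have dec: "\<exists>k. x - of_int k *\<^sub>R w \<in> K'" if x: "x \<in> K" for x
  proof -
    obtain a where a: "x $ i = of_int a" using x insert.prems(1) by (meson Ints_cases lattice_points_simps(1) subsetD)
    then have "a \<in> S" using x by (auto simp: S_def)
    then obtain k where "a = d * k" using d by blast
    then have "(x - of_int k *\<^sub>R w) $ i = 0" using a w(2) by simp
    then show ?thesis unfolding K'_def using insert.prems(3)[OF x mult] by blast
  qed
  show ?case
  proof (cases "d = 0")
    case True
    have "K = K'"
    proof
      show "K \<subseteq> K'"
      proof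
        fix x assume x: "x \<in> K"
        from dec[OF x] show "x \<in> K'" using x w(2) True by (auto simp: K'_def)
      qed
    qed (auto simp: K'_def)
    then show ?thesis using B by blast
  next
    case False
    have "y $ i = 0" if "y \<in> span B" for y
      using that by (induction rule: span_induct_alt) (use B(1) in \<open>auto simp: K'_def\<close>)
    then have wB: "w \<notin> span B" using w(2) False by auto
    then have wB': "w \<notin> B" using span_base by blast
    have "K \<subseteq> int_span (insert w B)"
    proof
      fix x assume "x \<in> K"
      then obtain k where "x - of_int k *\<^sub>R w \<in> int_span B" using dec B(4) by blast
      then obtain a where a: "\<forall>b\<in>B. a b \<in> \<int>" "x - of_int k *\<^sub>R w = (\<Sum>b\<in>B. a b *\<^sub>R b)"
        unfolding int_span_def by auto
      have "(\<Sum>b\<in>insert w B. (if b = w then of_int k else a b) *\<^sub>R b) =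
          of_int k *\<^sub>R w + (\<Sum>b\<in>B. (if b = w then of_int k else a b) *\<^sub>R b)"
        using B(2) wB' by simp
      also have "(\<Sum>b\<in>B. (if b = w then of_int k else a b) *\<^sub>R b) = (\<Sum>b\<in>B. a b *\<^sub>R b)"
        using wB' by (intro sum.cong) auto
      finally have "x = (\<Sum>b\<in>insert w B. (if b = w then of_int k else a b) *\<^sub>R b)"
        using a(2) by (simp add: algebra_simps)
      then show "x \<in> int_span (insert w B)" unfolding int_span_def using a(1)
        by (intro CollectI exI[of _ "\<lambda>b. if b = w then of_int k else a b"]) auto
    qed
    moreover have "independent (insert w B)" using wB B(3) by (rule independent_insertI)
    moreover have "insert w B \<subseteq> K" using w(1) B(1) by (auto simp: K'_def)
    ultimately show ?thesis using B(2) by blast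
  qed
qed

text \<open>The vectors \<open>w m\<close>, dual to the functionals, split the lattice into their
  integral span and the common kernel \<open>K\<close>. A basis of \<open>K\<close> together with
  the \<open>w m\<close> is a lattice basis, which \<open>g\<close> sends to the unit
  vectors.\<close>

lemma unimodular_completion:
  fixes u :: "'m \<Rightarrow> real^'n \<Rightarrow> real" and w :: "'m \<Rightarrow> real^'n"
  assumes fin: "finite M" and lin: "\<And>m. m \<in> M \<Longrightarrow> linear (u m)"
    and int: "\<And>m x. m \<in> M \<Longrightarrow> x \<in> lattice_points \<Longrightarrow> u m x \<in> \<int>"
    and w: "\<And>m. m \<in> M \<Longrightarrow> w m \<in> lattice_points"
    and dual: "\<And>m m'. m \<in> M \<Longrightarrow> m' \<in> M \<Longrightarrow> u m (w m') = (if m = m' then 1 else 0)"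
  obtains g :: "real^'n \<Rightarrow> real^'n" and j :: "'m \<Rightarrow> 'n" where
    "linear g" "bij g" "g ` lattice_points = lattice_points" "inj_on j M"
    "\<And>m x. m \<in> M \<Longrightarrow> g x $ j m = u m x"
proof -
  define K where "K = {x\<in>lattice_points. \<forall>m\<in>M. u m x = 0}"
  have "\<exists>B\<subseteq>K. finite B \<and> independent B \<and> K \<subseteq> int_span B"
    by (rule lattice_subgroup_basis[of UNIV])
      (auto simp: K_def linear_0[OF lin] linear_diff[OF lin])
  then obtain B where B: "B \<subseteq> K" "finite B" "independent B" "K \<subseteq> int_span B" by blast
  define W where "W = w ` M"
  have inj_w: "inj_on w M"
  proof (rule inj_onI)
    fix m m' assume m: "m \<in> M" "m' \<in> M" "w m = w m'"
    then show "m = m'" using dual[OF m(1,1)] dual[OF m(1,2)] by (metis zero_neq_one)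
  qed
  have u_B: "u m y = 0" if "m \<in> M" "y \<in> span B" for m y
    by (rule linear_eq_0_on_span[OF lin[OF that(1)] _ that(2)]) (use B(1) that(1) in \<open>auto simp: K_def\<close>)
  have u_sum: "u m (\<Sum>m'\<in>M. a m' *\<^sub>R w m') = a m" if m: "m \<in> M" for a m
  proof -
    have "u m (\<Sum>m'\<in>M. a m' *\<^sub>R w m') = (\<Sum>m'\<in>M. a m' * u m (w m'))"
      by (simp add: linear_sum[OF lin[OF m]] linear_scale[OF lin[OF m]])
    also have "\<dots> = (\<Sum>m'\<in>M. if m = m' then a m' else 0)"
      using m by (intro sum.cong) (auto simp: dual)
    finally show ?thesis using fin m by simp
  qed
  \<comment> \<open>Integrality of the functionals makes the projection onto the \<open>w m\<close>
    a lattice point, so the remainder is one too.\<close>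
  have decomp: "x - (\<Sum>m\<in>M. u m x *\<^sub>R w m) \<in> K" if "x \<in> lattice_points" for x
    using that w int u_sum
    by (auto simp: K_def linear_diff[OF lin] intro!: lattice_points_simps(4) lattice_points_sum)
  have BW: "B \<inter> W = {}"
    using u_B span_base dual by (fastforce simp: W_def)
  have indep: "independent (B \<union> W)"
  proof
    assume "dependent (B \<union> W)"
    then obtain a where a: "(\<Sum>v\<in>B \<union> W. a v *\<^sub>R v) = 0" "\<exists>v\<in>B \<union> W. a v \<noteq> 0"
      using dependent_finite[of "B \<union> W"] B(2) fin by (auto simp: W_def)
    have eq: "(\<Sum>v\<in>B. a v *\<^sub>R v) + (\<Sum>m\<in>M. a (w m) *\<^sub>R w m) = 0"
      using a(1) BW B(2) fin inj_w by (simp add: sum.union_disjoint W_def sum.reindex)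
    have aW: "a (w m) = 0" if m: "m \<in> M" for m
    proof -
      have "u m ((\<Sum>v\<in>B. a v *\<^sub>R v) + (\<Sum>m\<in>M. a (w m) *\<^sub>R w m)) = a (w m)"
        using u_sum[OF m] u_B[OF m] by (simp add: linear_add[OF lin[OF m]] span_sum span_scale span_base)
      then show ?thesis using eq linear_0[OF lin[OF m]] by simp
    qed
    then have "(\<Sum>v\<in>B. a v *\<^sub>R v) = 0" using eq by simp
    moreover have "\<exists>v\<in>B. a v \<noteq> 0" using a(2) aW by (auto simp: W_def)
    ultimately show False using B(2,3) dependent_finite by blast
  qed
  have int_comb: "\<exists>a. (\<forall>v\<in>B \<union> W. a v \<in> \<int>) \<and> x = (\<Sum>v\<in>B \<union> W. a v *\<^sub>R v)"
    if x: "x \<in> lattice_points" for x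
  proof -
    obtain a where a: "\<forall>b\<in>B. a b \<in> \<int>" "x - (\<Sum>m\<in>M. u m x *\<^sub>R w m) = (\<Sum>b\<in>B. a b *\<^sub>R b)"
      using decomp[OF x] B(4) unfolding int_span_def by blast
    define a' where "a' v = (if v \<in> B then a v else u (inv_into M w v) x)" for v
    have "(\<Sum>v\<in>B \<union> W. a' v *\<^sub>R v) = (\<Sum>v\<in>B. a' v *\<^sub>R v) + (\<Sum>m\<in>M. a' (w m) *\<^sub>R w m)"
      using BW B(2) fin inj_w by (simp add: sum.union_disjoint W_def sum.reindex)
    also have "(\<Sum>v\<in>B. a' v *\<^sub>R v) = (\<Sum>v\<in>B. a v *\<^sub>R v)" by (simp add: a'_def)
    also have "(\<Sum>m\<in>M. a' (w m) *\<^sub>R w m) = (\<Sum>m\<in>M. u m x *\<^sub>R w m)"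
    proof (rule sum.cong)
      fix m assume "m \<in> M"
      moreover have "w m \<notin> B" using BW \<open>m \<in> M\<close> by (auto simp: W_def)
      ultimately show "a' (w m) *\<^sub>R w m = u m x *\<^sub>R w m" by (simp add: a'_def inv_into_f_f[OF inj_w])
    qed simp
    finally have "x = (\<Sum>v\<in>B \<union> W. a' v *\<^sub>R v)" using a(2) by (simp add: algebra_simps)
    moreover have "a' v \<in> \<int>" if "v \<in> B \<union> W" for v
      using that a(1) int[OF _ x] by (auto simp: a'_def W_def inv_into_f_f[OF inj_w])
    ultimately show ?thesis by blast
  qed
  have span: "span (B \<union> W) = UNIV"
  proof -
    have "axis i (1::real) \<in> span (B \<union> W)" for i :: 'n
    proof -
      obtain a where a: "axis i 1 = (\<Sum>v\<in>B \<union> W. a v *\<^sub>R v)"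
        using int_comb[OF lattice_points_simps(7)[of i]] by blast
      show ?thesis unfolding a by (intro span_sum span_scale span_base)
    qed
    then have "Basis \<subseteq> span (B \<union> W)" by (auto simp: Basis_vec_def)
    then show ?thesis using span_mono[of Basis "span (B \<union> W)"] unfolding span_span span_Basis by auto
  qed
  have finBW: "finite (B \<union> W)" using B(2) fin by (simp add: W_def)
  have "card (B \<union> W) = CARD('n)"
    using indep span by (metis dim_UNIV dim_span_eq_card_independent DIM_cart DIM_real mult_1_right)
  then obtain h :: "real^'n \<Rightarrow> 'n" where h: "bij_betw h (B \<union> W) UNIV"
    using finite_same_card_bij[OF finBW finite_class.finite_UNIV] by auto
  obtain g :: "real^'n \<Rightarrow> real^'n" where g: "linear g" "\<And>v. v \<in> B \<union> W \<Longrightarrow> g v = axis (h v) 1"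
    using linear_independent_extend[OF indep, of "\<lambda>v. axis (h v) 1"] by auto
  have g_comb: "g (\<Sum>v\<in>B \<union> W. a v *\<^sub>R v) $ h v' = a v'" if "v' \<in> B \<union> W" for a v'
  proof -
    have "g (\<Sum>v\<in>B \<union> W. a v *\<^sub>R v) $ h v' = (\<Sum>v\<in>B \<union> W. a v * (axis (h v) 1 $ h v'))"
      by (simp add: linear_sum[OF g(1)] linear_scale[OF g(1)] g(2))
    also have "\<dots> = (\<Sum>v\<in>B \<union> W. if v = v' then a v else 0)"
      using that h by (intro sum.cong) (auto simp: axis_def bij_betw_def inj_on_def)
    finally show ?thesis using finBW that by simp
  qed
  have h_ex: "\<exists>v\<in>B \<union> W. h v = i" for i using h by (metis UNIV_I bij_betw_iff_bijections)
  have comb: "\<exists>a. x = (\<Sum>v\<in>B \<union> W. a v *\<^sub>R v)" for x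
  proof -
    have "x \<in> range (\<lambda>a. \<Sum>v\<in>B \<union> W. a v *\<^sub>R v)"
      unfolding span_finite[OF finBW, symmetric] span by (rule UNIV_I)
    then show ?thesis by (rule imageE) (rule exI)
  qed
  have inj: "inj g"
  proof (subst linear_injective_0[OF g(1)], intro allI impI)
    fix x assume gx: "g x = 0"
    obtain a where a: "x = (\<Sum>v\<in>B \<union> W. a v *\<^sub>R v)" using comb by blast
    have "a v = 0" if "v \<in> B \<union> W" for v using g_comb[OF that, of a] gx a by simp
    then show "x = 0" unfolding a by (simp add: sum.neutral)
  qed
  have "bij g" using inj linear_injective_imp_surjective[OF g(1)] by (simp add: bij_def)
  moreover have "g ` lattice_points = lattice_points"
  proof (intro equalityI subsetI)
    fix y assume "y \<in> g ` lattice_points"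
    then obtain x where x: "x \<in> lattice_points" "y = g x" by blast
    then obtain a where a: "\<forall>v\<in>B \<union> W. a v \<in> \<int>" "x = (\<Sum>v\<in>B \<union> W. a v *\<^sub>R v)" using int_comb by blast
    show "y \<in> lattice_points" unfolding lattice_points_def
    proof (intro CollectI allI)
      fix i
      obtain v where "v \<in> B \<union> W" "h v = i" using h_ex by blast
      then show "y $ i \<in> \<int>" using g_comb[of v a] a x(2) by auto
    qed
  next
    fix y :: "real^'n" assume y: "y \<in> lattice_points"
    define x where "x = (\<Sum>v\<in>B \<union> W. (y $ h v) *\<^sub>R v)"
    have BWL: "v \<in> lattice_points" if "v \<in> B \<union> W" for v using that B(1) w by (auto simp: K_def W_def)
    have "x \<in> lattice_points" unfolding x_def using BWL y by (intro lattice_points_sum lattice_points_simps(6)) auto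
    moreover have "g x = y"
    proof (subst vec_eq_iff, intro allI)
      fix i
      obtain v where "v \<in> B \<union> W" "h v = i" using h_ex by blast
      then show "g x $ i = y $ i" using g_comb[of v "\<lambda>v. y $ h v"] by (auto simp: x_def)
    qed
    ultimately show "y \<in> g ` lattice_points" by blast
  qed
  moreover have "inj_on (\<lambda>m. h (w m)) M"
    using comp_inj_on[OF inj_w, of h] h by (auto simp: bij_betw_def W_def comp_def inj_on_Un intro: inj_on_subset)
  moreover have "g x $ h (w m) = u m x" if m: "m \<in> M" for m x
  proof (rule linear_eq_on[where B = "B \<union> W" and f = "\<lambda>x. g x $ h (w m)" and g = "u m"])
    show "linear (\<lambda>x. g x $ h (w m))"
      by (intro linearI) (simp_all add: linear_add[OF g(1)] linear_scale[OF g(1)])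
    show "linear (u m)" by (rule lin[OF m])
    show "x \<in> span (B \<union> W)" using span by simp
    fix v assume v: "v \<in> B \<union> W"
    have wm: "w m \<in> B \<union> W" using m by (simp add: W_def)
    have "h v = h (w m) \<longleftrightarrow> v = w m" using h v wm by (auto simp: bij_betw_def dest: inj_onD)
    then have 1: "g v $ h (w m) = (if v = w m then 1 else 0)" using g(2)[OF v] by (auto simp: axis_def)
    show "g v $ h (w m) = u m v"
    proof (cases "v \<in> B")
      case True
      then have "v \<noteq> w m" using BW m by (auto simp: W_def)
      then show ?thesis using 1 u_B[OF m span_base[OF True]] by simp
    next
      case False
      then obtain m' where "m' \<in> M" "v = w m'" using v by (auto simp: W_def)
      then show ?thesis using 1 dual[OF m] m inj_w by (auto dest: inj_onD)
    qed
  qed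
  ultimately show ?thesis using that[OF g(1), of "\<lambda>m. h (w m)"] by blast
qed

section \<open>The Cayley decomposition\<close>

lemma lattice_points_norm_ge_1:
  assumes "x \<in> lattice_points" "x \<noteq> 0"
  shows "norm x \<ge> 1"
proof -
  have "\<exists>i. x $ i \<noteq> 0" using assms(2) unfolding vec_eq_iff by simp
  then obtain i where i: "x $ i \<noteq> 0" ..
  have "\<bar>x $ i\<bar> \<ge> 1" using Ints_nonzero_abs_ge1[OF lattice_points_simps(1)[OF assms(1)] i] .
  then show ?thesis using component_le_norm_cart[of x i] by linarith
qed

lemma finite_lattice_bounded:
  fixes B :: "((real^'n) \<times> real) set"
  assumes "bounded B"
  shows "finite (lattice_points \<times> \<int> \<inter> B)"
proof -
  have "x = y" if "x \<in> lattice_points \<times> \<int>" "y \<in> lattice_points \<times> \<int>" "dist x y < 1"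
    for x y :: "(real^'n) \<times> real"
  proof -
    have "norm (fst x - fst y) < 1" "\<bar>snd x - snd y\<bar> < 1"
      using that(3) dist_fst_le[of x y] dist_snd_le[of x y] unfolding dist_norm real_norm_def by linarith+
    moreover have "fst x - fst y \<in> lattice_points" "snd x - snd y \<in> \<int>" using that by auto
    ultimately have "fst x - fst y = 0" "snd x - snd y = 0"
      using lattice_points_norm_ge_1[of "fst x - fst y"] Ints_nonzero_abs_ge1[of "snd x - snd y"]
      by (force simp: not_le)+
    then show ?thesis by (simp add: prod_eq_iff)
  qed
  then have "uniform_discrete (lattice_points \<times> \<int> \<inter> B)"
    unfolding uniform_discrete_def by (intro exI[of _ 1]) auto
  moreover have "bounded (lattice_points \<times> \<int> \<inter> B)" using assms by (rule bounded_subset) auto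
  ultimately show ?thesis using uniform_discrete_finite_iff by blast
qed

lemma span_homogenization:
  fixes S :: "(real^'n) set"
  assumes "aff_dim S = int CARD('n)"
  shows "span ((\<lambda>x. (x, 1::real)) ` S) = UNIV"
proof -
  let ?T = "span ((\<lambda>x. (x, 1::real)) ` S)"
  have "affine hull S = UNIV" using assms by (simp flip: aff_dim_eq_full)
  moreover have "(x, 1) \<in> ?T" if x: "x \<in> affine hull S" for x
  proof -
    obtain F c where F: "finite F" "F \<subseteq> S" "sum c F = 1" "(\<Sum>v\<in>F. c v *\<^sub>R v) = x"
      using x unfolding affine_hull_explicit by auto
    have "(x, 1) = (\<Sum>v\<in>F. c v *\<^sub>R (v, 1::real))"
      using F(3,4) by (simp add: prod_eq_iff fst_sum snd_sum)
    also have "\<dots> \<in> ?T" using F(2) by (intro span_sum span_scale span_base) auto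
    finally show ?thesis .
  qed
  ultimately have all: "(x, 1) \<in> ?T" for x by blast
  have "(x, t) \<in> ?T" for x t
  proof -
    have "(x, 1) - (0, 1) + t *\<^sub>R (0, 1) \<in> ?T" by (intro span_add span_diff span_scale all)
    then show ?thesis by simp
  qed
  then show ?thesis by auto
qed

lemma lattice_cone_homogenization:
  fixes S :: "(real^'n) set"
  assumes "finite S" "S \<subseteq> lattice_points" "aff_dim S = int CARD('n)"
  shows "lattice_cone ((\<lambda>x. (x, 1::real)) ` S) (lattice_points \<times> \<int>) snd"
proof (rule lattice_cone.intro)
  show "linear (snd :: (real^'n) \<times> real \<Rightarrow> real)" by (rule linear_snd)
  show "span ((\<lambda>x. (x, 1::real)) ` S) = UNIV" by (rule span_homogenization[OF assms(3)])
  show "finite (lattice_points \<times> \<int> \<inter> B)" if "bounded B" for B :: "((real^'n) \<times> real) set"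
    by (rule finite_lattice_bounded[OF that])
qed (use assms in auto)

lemma mem_homogenization_cone:
  fixes S :: "(real^'n) set"
  assumes "lattice_cone ((\<lambda>x. (x, 1::real)) ` S) (lattice_points \<times> \<int>) snd" "finite S" "S \<noteq> {}"
  shows "(y, real m) \<in> lattice_cone.pcone ((\<lambda>x. (x, 1)) ` S) \<longleftrightarrow> y \<in> (*\<^sub>R) (real m) ` (convex hull S)"
proof -
  interpret lattice_cone "(\<lambda>x. (x, 1::real)) ` S" "lattice_points \<times> \<int>" snd by (rule assms(1))
  have sum: "(\<Sum>v\<in>(\<lambda>x. (x, 1::real)) ` S. a v *\<^sub>R v) = (\<Sum>x\<in>S. a (x, 1) *\<^sub>R x, \<Sum>x\<in>S. a (x, 1))" for a
    by (subst sum.reindex) (auto simp: inj_on_def prod_eq_iff fst_sum snd_sum)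
  show ?thesis
  proof
    assume "(y, real m) \<in> pcone"
    then obtain a where a: "\<forall>v\<in>(\<lambda>x. (x, 1)) ` S. a v \<ge> 0" "(y, real m) = (\<Sum>v\<in>(\<lambda>x. (x, 1)) ` S. a v *\<^sub>R v)"
      by (rule coneE)
    have y: "y = (\<Sum>x\<in>S. a (x, 1) *\<^sub>R x)" "real m = (\<Sum>x\<in>S. a (x, 1))" using a(2) sum by auto
    show "y \<in> (*\<^sub>R) (real m) ` (convex hull S)"
    proof (cases "m = 0")
      \<comment> \<open>At height 0 the cone contains only the origin, and scaling by 0 yields
        \<open>{0}\<close> because \<open>S\<close> is nonempty.\<close>
      case True
      then have "\<forall>x\<in>S. a (x, 1) = 0" using y(2) a(1) assms(2) by (simp add: sum_nonneg_eq_0_iff)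
      then have "y = 0" using y(1) by simp
      moreover obtain p where "p \<in> convex hull S" using assms(3) by (metis all_not_in_conv convex_hull_eq_empty)
      ultimately show ?thesis using True by (intro image_eqI[of _ _ p]) auto
    next
      case False
      define p where "p = (\<Sum>x\<in>S. (a (x, 1) / m) *\<^sub>R x)"
      have "p \<in> convex hull S"
        unfolding p_def convex_hull_finite[OF assms(2)] using a(1) y(2) False
        by (intro CollectI exI[of _ "\<lambda>x. a (x, 1) / m"]) (auto simp flip: sum_divide_distrib)
      moreover have "y = real m *\<^sub>R p" using y(1) False by (simp add: p_def scaleR_sum_right)
      ultimately show ?thesis by blast
    qed
  next
    assume "y \<in> (*\<^sub>R) (real m) ` (convex hull S)"
    then obtain c where c: "\<forall>x\<in>S. 0 \<le> c x" "sum c S = 1" "y = real m *\<^sub>R (\<Sum>x\<in>S. c x *\<^sub>R x)"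
      unfolding convex_hull_finite[OF assms(2)] by blast
    have "(\<Sum>v\<in>(\<lambda>x. (x, 1::real)) ` S. (real m * c (fst v)) *\<^sub>R v) = (y, real m)"
      unfolding sum using c(2,3) by (simp add: scaleR_sum_right flip: sum_distrib_left)
    moreover have "(\<Sum>v\<in>(\<lambda>x. (x, 1::real)) ` S. (real m * c (fst v)) *\<^sub>R v) \<in> pcone"
      using c(1) by (intro coneI) auto
    ultimately show "(y, real m) \<in> pcone" by simp
  qed
qed

text \<open>The slice of the cone at height \<open>m\<close> is the dilate of the polytope by
  \<open>m\<close>, so the two series coincide; the exponents agree because the product space has
  dimension \<open>CARD('n) + 1\<close>.\<close>

lemma lattice_degree_eq_degree:
  fixes S :: "(real^'n) set"
  assumes "lattice_cone ((\<lambda>x. (x, 1::real)) ` S) (lattice_points \<times> \<int>) snd" "finite S" "S \<noteq> {}"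
  shows "lattice_degree (convex hull S) =
    lattice_cone.degree ((\<lambda>x. (x, 1)) ` S) (lattice_points \<times> \<int>) (snd :: (real^'n) \<times> real \<Rightarrow> real)"
proof -
  interpret lattice_cone "(\<lambda>x. (x, 1::real)) ` S" "lattice_points \<times> \<int>" snd by (rule assms(1))
  have "card ((*\<^sub>R) (real m) ` (convex hull S) \<inter> lattice_points) =
      card {x \<in> (lattice_points \<times> \<int>) \<inter> pcone. snd x = real m}" for m
  proof (rule bij_betw_same_card[of "\<lambda>y. (y, real m)"], unfold bij_betw_def, intro conjI)
    show "(\<lambda>y. (y, real m)) ` ((*\<^sub>R) (real m) ` (convex hull S) \<inter> lattice_points) =
        {x \<in> (lattice_points \<times> \<int>) \<inter> pcone. snd x = real m}"
      using mem_homogenization_cone[OF assms] by (auto simp: image_iff)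
  qed (auto simp: inj_on_def)
  then have "ehrhart_series (convex hull S) = hilbert_series ((lattice_points \<times> \<int>) \<inter> pcone)"
    by (simp add: ehrhart_series_def hilbert_series_def)
  then show ?thesis by (simp add: lattice_degree_def degree_def h_star_def)
qed

section \<open>Assembling the Cayley sum\<close>

lemma convex_hull_Union_convex_hulls:
  "convex hull (\<Union>k\<in>K. convex hull (A k)) = convex hull (\<Union>k\<in>K. A k)"
proof (rule hull_unique)
  show "(\<Union>k\<in>K. convex hull (A k)) \<subseteq> convex hull (\<Union>k\<in>K. A k)"
    by (intro UN_least hull_mono) auto
  fix C assume "(\<Union>k\<in>K. convex hull (A k)) \<subseteq> C" "convex C"
  then show "convex hull (\<Union>k\<in>K. A k) \<subseteq> C"
    by (intro hull_minimal) (use hull_subset in fastforce)+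
qed simp

text \<open>The fibres of \<open>S\<close> over the simplex vertices, translated so that their
  \<open>J\<close>-coordinates vanish, span the summands. \<open>cover\<close> makes the fibres
  exhaust \<open>S\<close>, and \<open>hit\<close> makes every summand nonempty.\<close>

lemma cayley_decomposesI:
  fixes S :: "(real^'n) set" and T :: "real^'n \<Rightarrow> real^'n"
  assumes S: "finite S" "S \<subseteq> lattice_points"
    and g: "linear g" "bij g" "g ` lattice_points = lattice_points" "c \<in> lattice_points"
    and T: "\<And>x. T x = g x + c"
    and cover: "\<And>s. s \<in> S \<Longrightarrow> \<exists>k\<in>insert None (Some ` J). \<forall>i\<in>J. T s $ i = cayley_vertex k $ i"
    and hit: "\<And>k. k \<in> insert None (Some ` J) \<Longrightarrow> \<exists>s\<in>S. \<forall>i\<in>J. T s $ i = cayley_vertex k $ i"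
  shows "cayley_decomposes (convex hull S) (CARD('n) - card J)"
proof -
  define F where "F k = {s\<in>S. \<forall>i\<in>J. T s $ i = cayley_vertex k $ i}" for k
  define Q where "Q k = convex hull ((\<lambda>s. T s - cayley_vertex k) ` F k)" for k :: "'n option"
  have T': "T = (\<lambda>x. g x + c)" using T by blast
  have cv: "cayley_vertex k \<in> lattice_points" for k :: "'n option"
    by (cases k) (simp_all add: cayley_vertex_def)
  have TL: "T ` lattice_points = lattice_points"
  proof -
    have "T ` lattice_points = (\<lambda>x. x + c) ` g ` lattice_points" by (simp add: T' image_image)
    also have "\<dots> = lattice_points" unfolding g(3)
    proof (intro equalityI subsetI)
      fix y :: "real^'n" assume "y \<in> lattice_points"
      then show "y \<in> (\<lambda>x. x + c) ` lattice_points" using g(4) by (intro image_eqI[of _ _ "y - c"]) auto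
    qed (use g(4) in auto)
    finally show ?thesis .
  qed
  have "bij ((\<lambda>x. x + c) \<circ> g)" using g(2) by (rule bij_comp) (rule bij_plus_right)
  then have "bij T" by (simp add: T' comp_def)
  moreover have "lattice_polytope (Q k) \<and> (\<forall>x\<in>Q k. \<forall>j\<in>J. x $ j = 0)" if k: "k \<in> insert None (Some ` J)" for k
  proof
    have "T s - cayley_vertex k \<in> lattice_points" if "s \<in> F k" for s
    proof -
      have "T s \<in> lattice_points" using that S(2) TL by (auto simp: F_def)
      then show ?thesis using cv by simp
    qed
    moreover have "F k \<noteq> {}" using hit[OF k] by (auto simp: F_def)
    moreover have "finite (F k)" using S(1) by (simp add: F_def)
    ultimately show "lattice_polytope (Q k)" unfolding lattice_polytope_def Q_def
      by (intro exI[of _ "(\<lambda>s. T s - cayley_vertex k) ` F k"]) auto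
    have "Q k \<subseteq> {x. \<forall>j\<in>J. x $ j = 0}" unfolding Q_def
      by (rule hull_minimal) (auto simp: F_def convex_def)
    then show "\<forall>x\<in>Q k. \<forall>j\<in>J. x $ j = 0" by blast
  qed
  moreover have "T ` (convex hull S) = convex hull (\<Union>k\<in>insert None (Some ` J). (\<lambda>x. x + cayley_vertex k) ` Q k)"
  proof -
    have Qk: "(\<lambda>x. x + cayley_vertex k) ` Q k = convex hull (T ` F k)" for k
    proof -
      have "(\<lambda>x. x + cayley_vertex k) ` Q k = (\<lambda>x. cayley_vertex k + x) ` Q k"
        by (simp add: add.commute)
      also have "\<dots> = convex hull (T ` F k)"
        unfolding Q_def convex_hull_translation[symmetric] image_image by simp
      finally show ?thesis .
    qed
    have "S = (\<Union>k\<in>insert None (Some ` J). F k)" using cover by (auto simp: F_def)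
    then have "T ` S = (\<Union>k\<in>insert None (Some ` J). T ` F k)" by blast
    then have "convex hull (\<Union>k\<in>insert None (Some ` J). (\<lambda>x. x + cayley_vertex k) ` Q k) = convex hull (T ` S)"
      unfolding Qk convex_hull_Union_convex_hulls by simp
    also have "T ` S = (\<lambda>x. c + x) ` g ` S" by (simp add: T' image_image add.commute)
    also have "convex hull \<dots> = (\<lambda>x. c + x) ` g ` (convex hull S)"
      unfolding convex_hull_translation convex_hull_linear_image[OF g(1)] ..
    also have "\<dots> = T ` (convex hull S)" by (simp add: T' image_image add.commute)
    finally show ?thesis ..
  qed
  moreover have "CARD('n) - card J + card J = CARD('n)" using card_mono[of UNIV J] by simp
  ultimately show ?thesis unfolding cayley_decomposes_def using g(1) TL unfolding T' by blast
qed

theorem theorem1p2: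
  fixes P :: "(real^'n) set"
  assumes "lattice_polytope P"
    and "aff_dim P = int CARD('n)"
    and "lattice_degree P \<ge> 1"
  shows "\<exists>q. cayley_decomposes P q \<and>
           real q \<le> (real (lattice_degree P) ^ 2 + 19 * real (lattice_degree P) - 4) / 2"
proof -
  obtain S where S: "finite S" "S \<noteq> {}" "S \<subseteq> lattice_points" "P = convex hull S"
    using assms(1) unfolding lattice_polytope_def by blast
  let ?V = "(\<lambda>x. (x, 1::real)) ` S"
  have cone: "lattice_cone ?V (lattice_points \<times> \<int>) snd"
    using S assms(2) by (intro lattice_cone_homogenization) (simp_all add: aff_dim_convex_hull)
  interpret lattice_cone ?V "lattice_points \<times> \<int>" snd by (rule cone)
  have deg: "lattice_degree P = degree" unfolding S(4) by (rule lattice_degree_eq_degree[OF cone S(1,2)])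
  obtain M v0 u where M: "M \<subseteq> ?V" and v0: "v0 \<in> ?V" and lin: "\<And>m. m \<in> M \<Longrightarrow> linear (u m)"
    and int: "\<And>m x. m \<in> M \<Longrightarrow> x \<in> lattice_points \<times> \<int> \<Longrightarrow> u m x \<in> \<int>"
    and zero_one: "\<And>m v. m \<in> M \<Longrightarrow> v \<in> ?V \<Longrightarrow> u m v = 0 \<or> u m v = (1::real)"
    and single: "\<And>m m' v. m \<in> M \<Longrightarrow> m' \<in> M \<Longrightarrow> v \<in> ?V \<Longrightarrow> u m v \<noteq> 0 \<Longrightarrow> u m' v \<noteq> 0 \<Longrightarrow> m = m'"
    and dual: "\<And>m m'. m \<in> M \<Longrightarrow> m' \<in> M \<Longrightarrow> u m m' = (if m = m' then 1 else 0)"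
    and u_v0: "\<And>m. m \<in> M \<Longrightarrow> u m v0 = 0"
    and card: "2 * DIM((real^'n) \<times> real) \<le> 2 * card M + degree ^ 2 + 13 * degree"
  proof (rule zero_one_functionals[OF assms(3)[unfolded deg]], goal_cases)
    case (1 M v0 u)
    show ?case by (rule 1(1)[of M v0 u]; fact 1(2-))
  qed
  have finM: "finite M" using M S(1) finite_subset by blast
  have V: "(fst v, 1) = v" "fst v \<in> S" if "v \<in> ?V" for v using that by auto
  obtain g :: "real^'n \<Rightarrow> real^'n" and j where g: "linear g" "bij g" "g ` lattice_points = lattice_points"
    and j: "inj_on j M" and gj: "\<And>m x. m \<in> M \<Longrightarrow> g x $ j m = u m (x, 0)"
  \<comment> \<open>The functionals live on \<open>(real^'n) \<times> real\<close>; their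
    restrictions to the first factor are paired with differences of points of \<open>S\<close>. As
    \<open>u m v0 = 0\<close>, the vectors \<open>fst m - fst v0\<close> are dual to them.\<close>
  proof (rule unimodular_completion[of M "\<lambda>m x. u m (x, 0)" "\<lambda>m. fst m - fst v0"])
    show "linear (\<lambda>x. u m (x, 0))" if "m \<in> M" for m
    proof (rule linearI)
      fix x y show "u m (x + y, 0) = u m (x, 0) + u m (y, 0)"
        using linear_add[OF lin[OF that], of "(x, 0)" "(y, 0)"] by simp
    next
      fix r x show "u m (r *\<^sub>R x, 0) = r *\<^sub>R u m (x, 0)"
        using linear_scale[OF lin[OF that], of r "(x, 0)"] by simp
    qed
    show "fst m - fst v0 \<in> lattice_points" if "m \<in> M" for m
      using V(2)[OF v0] V(2)[of m] M that S(3) by (intro lattice_points_simps(4)) auto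
    show "u m (fst m' - fst v0, 0) = (if m = m' then 1 else 0)" if "m \<in> M" "m' \<in> M" for m m'
    proof -
      have "(fst m' - fst v0, 0) = m' - v0" using V(1)[OF v0] V(1)[of m'] M that(2) by (auto simp: prod_eq_iff)
      then show ?thesis using linear_diff[OF lin[OF that(1)], of m' v0] dual[OF that] u_v0[OF that(1)] by simp
    qed
  qed (use finM int in auto)
  \<comment> \<open>The constant terms \<open>u m (0, 1)\<close>, integral because
    \<open>(0, 1)\<close> is a lattice point, make \<open>u m (x, 1)\<close> the coordinate of
    \<open>T x\<close> at \<open>j m\<close>.\<close>
  define c :: "real^'n" where "c = (\<chi> i. if i \<in> j ` M then u (inv_into M j i) (0, 1) else 0)"
  define T where "T x = g x + c" for x
  have c_j: "c $ j m = u m (0, 1)" if "m \<in> M" for m using that j by (simp add: c_def)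
  have c_L: "c \<in> lattice_points" unfolding lattice_points_def
    using int[of _ "(0, 1)"] j by (auto simp: c_def)
  have T_j: "T x $ j m = u m (x, 1)" if "m \<in> M" for m x
    using linear_add[OF lin[OF that], of "(x, 0)" "(0, 1)"] by (simp add: T_def gj c_j that)
  have cay: "cayley_decomposes P (CARD('n) - card (j ` M))" unfolding S(4)
  proof (rule cayley_decomposesI[OF S(1,3) g c_L T_def])
    fix s assume s: "s \<in> S"
    show "\<exists>k\<in>insert None (Some ` j ` M). \<forall>i\<in>j ` M. T s $ i = cayley_vertex k $ i"
    proof (cases "\<forall>m\<in>M. u m (s, 1) = 0")
      case True
      then show ?thesis by (intro bexI[of _ None]) (auto simp: cayley_vertex_def T_j)
    next
      case False
      then obtain m where m: "m \<in> M" "u m (s, 1) \<noteq> 0" by blast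
      have "T s $ j m' = axis (j m) 1 $ j m'" if "m' \<in> M" for m'
      proof (cases "m' = m")
        case True
        then show ?thesis using zero_one[OF m(1), of "(s, 1)"] s m by (simp add: T_j)
      next
        case False
        then have "j m' \<noteq> j m" using j that m(1) by (auto dest: inj_onD)
        moreover have "u m' (s, 1) = 0" using single[OF that m(1), of "(s, 1)"] False s m(2) by auto
        ultimately show ?thesis using that by (simp add: T_j axis_def)
      qed
      then show ?thesis using m(1) by (intro bexI[of _ "Some (j m)"]) (auto simp: cayley_vertex_def)
    qed
  next
    fix k assume k: "k \<in> insert None (Some ` j ` M)"
    show "\<exists>s\<in>S. \<forall>i\<in>j ` M. T s $ i = cayley_vertex k $ i"
    proof (cases k)
      case None
      then show ?thesis using V[OF v0] u_v0
        by (intro bexI[of _ "fst v0"]) (auto simp: cayley_vertex_def T_j)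
    next
      case (Some i)
      then obtain m where m: "m \<in> M" "k = Some (j m)" using k by auto
      have "T (fst m) $ j m' = axis (j m) 1 $ j m'" if "m' \<in> M" for m'
      proof -
        have "u m' (fst m, 1) = (if m' = m then 1 else 0)" using V(1)[of m] M m(1) dual[OF that m(1)] by auto
        moreover have "j m' = j m \<longleftrightarrow> m' = m" using j that m(1) by (auto dest: inj_onD)
        ultimately show ?thesis using that by (simp add: T_j axis_def)
      qed
      then show ?thesis using V(2)[of m] M m by (intro bexI[of _ "fst m"]) (auto simp: cayley_vertex_def)
    qed
  qed
  have "card M \<le> CARD('n)" using card_mono[of UNIV "j ` M"] card_image[OF j] by simp
  \<comment> \<open>The summand 2 comes from the dimension \<open>CARD('n) + 1\<close> of the
    homogenized space; \<open>card M \<le> CARD('n)\<close> keeps the natural subtraction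
    exact.\<close>
  then have "2 * (CARD('n) - card (j ` M)) + 2 \<le> degree ^ 2 + 13 * degree"
    using card card_image[OF j] by simp
  then have "real (2 * (CARD('n) - card (j ` M)) + 2) \<le> real (degree ^ 2 + 13 * degree)"
    by (rule of_nat_mono)
  moreover have "degree \<ge> 1" using assms(3) deg by simp
  \<comment> \<open>\<open>d^2 + 13d - 2 \<le> d^2 + 19d - 4\<close> holds because
    \<open>6 * d \<ge> 2\<close> for \<open>d \<ge> 1\<close>.\<close>
  ultimately have "real (CARD('n) - card (j ` M)) \<le> (real degree ^ 2 + 19 * real degree - 4) / 2"
    by simp
  then show ?thesis using cay deg by auto
qed

end
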